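(* Let $D$ be an (oriented) alternating diagram of a knot. Then $$s(D)=U(D).$$
   Context: Rasmussen invariant: for a diagram $D$ of a knot $K$, consider Lee's filtered chain complex $\mathscr{F}^jC^i(D)$ with complex coefficients, i.e. the perturbed Khovanov complex built from the Frobenius algebra $\mathbb{C}\hookrightarrow \mathbb{C}[x]/(x^2-1)$, where $i$ is the homological grading and $\cdots\subseteq\mathscr{F}^{j+1}C^i\subseteq\mathscr{F}^jC^i\subseteq\cdots$ is the quantum filtration. Its homology is 2-dimensional, supported in $i=0$, and generated by Lee's canonical classes $[\mathfrak{s}_o],[\mathfrak{s}_{\bar o}]$ associated with the orientation $o$ of $D$ and the reverse orientation. Let $s_{\min}(D)$ be the largest $j$ such that $[\mathfrak{s}_o]$ (equivalently $[\mathfrak{s}_{\bar o}]$) lies in $\mathscr{F}^jH^0(D)$. Then $s(D)=s(K)=s_{\min}(D)+1\in 2\mathbb{Z}$. This depends only on $K$, and with this normalization $s(K)=2g^*(K)$ for positive knots, where $g^*$ is the smooth slice genus. Seifert graph: let $O(D)$ be the oriented resolution of $D$ (every crossing is smoothed respecting orientation), a disjoint union of circles. The Seifert graph $T(D)$ has one node for each circle of $O(D)$ and, for each positive (respectively negative) crossing of $D$, one edge decorated with $+$ (respectively $-$) joining the two distinct circles on which the smoothed crossing lies. The subgraph $T^-(D)$ (respectively $T^+(D)$) is obtained from $T(D)$ by removing all edges decorated with $+$ (respectively $-$), keeping all nodes. Let $w(D)$ be the writhe of $D$ (number of positive crossings minus number of negative crossings). Define $$U(D)=\#\mathrm{nodes}(T(D))-2\,\#\mathrm{components}(T^-(D))+w(D)+1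 .$$ *)

theory Defs
  imports Complex_Main
begin

definition classes :: "'a set \<Rightarrow> ('a \<times> 'a) set \<Rightarrow> 'a set set" where
  "classes A r = A // {(x, y). x \<in> A \<and> y \<in> A \<and> (x, y) \<in> (r \<union> r\<inverse>)\<^sup>*}"

section \<open>Oriented knot diagrams\<close>

text \<open>
  A diagram is given by its combinatorial type (a planar diagram code).  An arc is an oriented
  segment of the diagram between two consecutive crossing points.  At each crossing one
  records the sign and the four arc ends: the under- and the over-strand, each with its incoming
  and outgoing arc.  The cyclic order of the ends around the crossing is determined by the
  sign: counterclockwise it is (under-in, over-out, under-out, over-in) at a positive crossing and
  (under-in, over-in, under-out, over-out) at a negative one.
\<close>

record crossing =
  pos :: bool
  u_in :: nat
  u_out :: nat
  o_in :: nat
  o_out :: nat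

datatype side = L | R

text \<open>
  The field \<open>outer\<close> is a side of an arc, left or right with respect to the orientation,
  that faces the unbounded region.
\<close>

record diagram =
  crossings :: "crossing list"
  outer :: "nat \<times> side"

definition indices :: "diagram \<Rightarrow> nat set" where
  "indices D = {..<length (crossings D)}"

text \<open>
  A diagram with \<open>n > 0\<close> crossings has \<open>2 n\<close> arcs; the diagram without crossings has one closed arc.
\<close>

definition arcs :: "diagram \<Rightarrow> nat set" where
  "arcs D = {..<max 1 (2 * length (crossings D))}"

definition strand_rel :: "diagram \<Rightarrow> (nat \<times> nat) set" where
  "strand_rel D = (\<Union>c\<in>set (crossings D). {(u_in c, u_out c), (o_in c, o_out c)})"

text \<open>
  The four corners at a crossing: each of them identifies the sides of two arcs that face the same
  region.  With both strands pointing upwards the corners are listed in the order bottom, right,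
  top, left for a positive crossing, and bottom, left, top, right for a negative one.
\<close>

definition corners :: "crossing \<Rightarrow> ((nat \<times> side) \<times> (nat \<times> side)) set" where
  "corners c = (let l = (if pos c then L else R); r = (if pos c then R else L) in
     {((u_in c, l), (o_in c, r)),
      ((u_in c, r), (o_out c, r)),
      ((o_out c, l), (u_out c, r)),
      ((u_out c, l), (o_in c, l))})"

definition regions :: "diagram \<Rightarrow> (nat \<times> side) set set" where
  "regions D = classes (arcs D \<times> UNIV) (\<Union>c\<in>set (crossings D). corners c)"

text \<open>
  The first two conditions say that every arc end is used exactly once (by counting, there are as
  many incoming, respectively outgoing, slots as arcs), the third one that there is a single
  component, and the fourth one is Euler's formula
  \<open>V - E + F = n - 2 n + F = 2\<close>, which says that the diagram lies on the sphere.
\<close>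

definition knot_diagram :: "diagram \<Rightarrow> bool" where
  "knot_diagram D \<longleftrightarrow>
     (let cs = crossings D; ins = map u_in cs @ map o_in cs; outs = map u_out cs @ map o_out cs in
        distinct ins \<and> set ins \<subseteq> arcs D \<and>
        distinct outs \<and> set outs \<subseteq> arcs D \<and>
        (\<forall>e\<in>arcs D. \<forall>f\<in>arcs D. (e, f) \<in> (strand_rel D)\<^sup>*) \<and>
        card (regions D) = length cs + 2 \<and>
        fst (outer D) \<in> arcs D)"

text \<open>Along the knot, an over-passage is followed by an under-passage and vice versa.\<close>

definition alternating :: "diagram \<Rightarrow> bool" where
  "alternating D \<longleftrightarrow>
     o_out ` set (crossings D) = u_in ` set (crossings D) \<and>
     u_out ` set (crossings D) = o_in ` set (crossings D)"

definition positives :: "diagram \<Rightarrow> nat set" where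
  "positives D = {i \<in> indices D. pos (crossings D ! i)}"

definition negatives :: "diagram \<Rightarrow> nat set" where
  "negatives D = {i \<in> indices D. \<not> pos (crossings D ! i)}"

definition writhe :: "diagram \<Rightarrow> int" where
  "writhe D = int (card (positives D)) - int (card (negatives D))"

section \<open>Resolutions\<close>

text \<open>
  A complete resolution is given by the set \<open>S\<close> of the crossings that are 1-smoothed.  The
  0-smoothing respects the orientation at a positive crossing, the 1-smoothing does so at a
  negative one.
\<close>

definition smoothing :: "crossing \<Rightarrow> bool \<Rightarrow> (nat \<times> nat) set" where
  "smoothing c one =
     (if pos c \<noteq> one then {(u_in c, o_out c), (o_in c, u_out c)}
      else {(u_in c, o_in c), (u_out c, o_out c)})"

text \<open>A circle of a resolution is identified with the set of arcs it consists of.\<close>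

definition circles :: "diagram \<Rightarrow> nat set \<Rightarrow> nat set set" where
  "circles D S = classes (arcs D) (\<Union>i\<in>indices D. smoothing (crossings D ! i) (i \<in> S))"

definition oriented_resolution :: "diagram \<Rightarrow> nat set set" where
  "oriented_resolution D = circles D (negatives D)"

section \<open>Lee's filtered complex\<close>

text \<open>
  The basis \<open>1, x\<close> of the Frobenius algebra \<open>\<complex>[x]/(x\<^sup>2 - 1)\<close> with counit
  \<open>\<epsilon>(1) = 0\<close>, \<open>\<epsilon>(x) = 1\<close>.  Products of basis elements are basis elements, and
  coproducts are sums of distinct tensors of basis elements:
  \<open>\<Delta>(1) = 1 \<otimes> x + x \<otimes> 1\<close> and \<open>\<Delta>(x) = x \<otimes> x + 1 \<otimes> 1\<close>.
\<close>

datatype gen = One | X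

fun mul :: "gen \<Rightarrow> gen \<Rightarrow> gen" where
  "mul One a = a"
| "mul a One = a"
| "mul X X = One"

fun comul :: "gen \<Rightarrow> (gen \<times> gen) set" where
  "comul One = {(One, X), (X, One)}"
| "comul X = {(X, X), (One, One)}"

text \<open>
  A basis element of the complex is a pair \<open>(S, A)\<close>, where \<open>S\<close> is a resolution and
  \<open>A\<close> is the set of its circles labelled by \<open>x\<close>; the other circles are labelled by \<open>1\<close>.
\<close>

type_synonym state = "nat set \<times> nat set set"
type_synonym chain = "state \<Rightarrow> complex"

definition label :: "nat set set \<Rightarrow> nat set \<Rightarrow> gen" where
  "label A C = (if C \<in> A then X else One)"

definition states :: "diagram \<Rightarrow> state set" where
  "states D = {(S, A). S \<subseteq> indices D \<and> A \<subseteq> circles D S}"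

definition hdeg :: "diagram \<Rightarrow> state \<Rightarrow> int" where
  "hdeg D = (\<lambda>(S, A). int (card S) - int (card (negatives D)))"

text \<open>
  The quantum degree: \<open>1\<close> has degree \<open>1\<close> and \<open>x\<close> has degree \<open>-1\<close>, shifted by
  \<open>|S| + n\<^sub>+ - 2 n\<^sub>-\<close>.
\<close>

definition qdeg :: "diagram \<Rightarrow> state \<Rightarrow> int" where
  "qdeg D = (\<lambda>(S, A). int (card (circles D S - A)) - int (card A)
      + int (card S) + int (card (positives D)) - 2 * int (card (negatives D)))"

definition chains :: "diagram \<Rightarrow> int \<Rightarrow> chain set" where
  "chains D i = {f. \<forall>s. f s \<noteq> 0 \<longrightarrow> s \<in> states D \<and> hdeg D s = i}"

definition filtered_chains :: "diagram \<Rightarrow> int \<Rightarrow> int \<Rightarrow> chain set" where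
  "filtered_chains D j i = {f \<in> chains D i. \<forall>s. f s \<noteq> 0 \<longrightarrow> j \<le> qdeg D s}"

text \<open>
  The matrix entry from \<open>(S, A)\<close> to \<open>(S', A')\<close> of the map belonging to an edge \<open>S \<rightarrow> S'\<close>
  of the cube of resolutions: multiplication if two circles merge, comultiplication if one circle
  splits, tensored with the identity on the circles common to both resolutions.
\<close>

definition edge_coeff :: "diagram \<Rightarrow> state \<Rightarrow> state \<Rightarrow> complex" where
  "edge_coeff D = (\<lambda>(S, A) (S', A').
     let old = circles D S - circles D S'; new = circles D S' - circles D S in
     if (\<forall>C\<in>circles D S \<inter> circles D S'. label A C = label A' C) \<and>
        ((\<exists>p q r. old = {p, q} \<and> p \<noteq> q \<and> new = {r} \<and>
            label A' r = mul (label A p) (label A q)) \<or>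
         (\<exists>p q r. old = {r} \<and> new = {p, q} \<and> p \<noteq> q \<and>
            (label A' p, label A' q) \<in> comul (label A r)))
     then 1 else 0)"

definition lee_d :: "diagram \<Rightarrow> chain \<Rightarrow> chain" where
  "lee_d D f = (\<lambda>(S', A').
     if (S', A') \<in> states D then
       (\<Sum>i\<in>S'. \<Sum>A\<in>Pow (circles D (S' - {i})).
          (-1) ^ card {k \<in> S'. k < i} * edge_coeff D (S' - {i}, A) (S', A') * f (S' - {i}, A))
     else 0)"

definition cocycles :: "diagram \<Rightarrow> int \<Rightarrow> chain set" where
  "cocycles D i = {f \<in> chains D i. lee_d D f = (\<lambda>_. 0)}"

definition cohomology_class :: "diagram \<Rightarrow> int \<Rightarrow> chain \<Rightarrow> chain set" where
  "cohomology_class D i f = {g. \<exists>b\<in>chains D (i - 1). g = (\<lambda>s. f s + lee_d D b s)}"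

text \<open>The induced filtration \<open>\<F>\<^sup>j H\<^sup>i\<close>: the classes represented by a cocycle in
  \<open>\<F>\<^sup>j C\<^sup>i\<close>.\<close>

definition filtered_cohomology :: "diagram \<Rightarrow> int \<Rightarrow> int \<Rightarrow> chain set set" where
  "filtered_cohomology D j i =
     cohomology_class D i ` (filtered_chains D j i \<inter> cocycles D i)"

section \<open>Lee's canonical class and the Rasmussen invariant\<close>

definition region_of :: "diagram \<Rightarrow> nat \<times> side \<Rightarrow> (nat \<times> side) set" where
  "region_of D p = (THE r. r \<in> regions D \<and> p \<in> r)"

text \<open>
  The black regions of the chequerboard colouring with white unbounded region.  The two regions
  at opposite corners of a crossing have the same colour, so this is also the colouring of the
  complement of the oriented resolution by the parity of the number of circles separating a region
  from infinity.
\<close>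

definition black :: "diagram \<Rightarrow> (nat \<times> side) set set" where
  "black D = (THE B. B \<subseteq> regions D \<and>
     (\<forall>e\<in>arcs D. (region_of D (e, L) \<in> B) \<noteq> (region_of D (e, R) \<in> B)) \<and>
     region_of D (outer D) \<notin> B)"

text \<open>
  The canonical generator \<open>\<s>\<^sub>o\<close> is the tensor product over the circles of the oriented
  resolution of \<open>a = x + 1\<close> and \<open>b = x - 1\<close>.  A circle is labelled by \<open>a\<close> or \<open>b\<close>
  according to whether the number of circles separating it from infinity, plus one if it is
  oriented counterclockwise, is even or odd; equivalently, according to whether the region
  immediately to its left is white or black.
\<close>

definition b_circles :: "diagram \<Rightarrow> nat set set" where
  "b_circles D = {C \<in> oriented_resolution D. \<exists>e\<in>C. region_of D (e, L) \<in> black D}"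

definition canonical_generator :: "diagram \<Rightarrow> chain" where
  "canonical_generator D = (\<lambda>(S, A).
     if S = negatives D \<and> A \<subseteq> oriented_resolution D then
       (\<Prod>C\<in>oriented_resolution D. if C \<in> A then 1 else if C \<in> b_circles D then -1 else 1)
     else 0)"

definition s_min :: "diagram \<Rightarrow> int" where
  "s_min D =
     (GREATEST j. cohomology_class D 0 (canonical_generator D) \<in> filtered_cohomology D j 0)"

definition rasmussen_s :: "diagram \<Rightarrow> int" where
  "rasmussen_s D = s_min D + 1"

section \<open>The Seifert graph and the number \<open>U(D)\<close>\<close>

text \<open>A multigraph with signed edges (\<open>True\<close> for \<open>+\<close>).\<close>

record ('v, 'e) signed_graph =
  nodes :: "'v set"
  edges :: "'e set"
  ends :: "'e \<Rightarrow> 'v set"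
  plus :: "'e \<Rightarrow> bool"

definition components :: "('v, 'e) signed_graph \<Rightarrow> 'v set set" where
  "components G = classes (nodes G) {(v, w). \<exists>e\<in>edges G. ends G e = {v, w}}"

definition seifert_graph :: "diagram \<Rightarrow> (nat set, nat) signed_graph" where
  "seifert_graph D =
     \<lparr> nodes = oriented_resolution D,
       edges = indices D,
       ends = (\<lambda>i. let c = crossings D ! i in
         {C \<in> oriented_resolution D. C \<inter> {u_in c, u_out c, o_in c, o_out c} \<noteq> {}}),
       plus = (\<lambda>i. pos (crossings D ! i)) \<rparr>"

definition negative_subgraph :: "('v, 'e) signed_graph \<Rightarrow> ('v, 'e) signed_graph" where
  "negative_subgraph G = G\<lparr>edges := {e \<in> edges G. \<not> plus G e}\<rparr>"

definition U :: "diagram \<Rightarrow> int" where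
  "U D = int (card (nodes (seifert_graph D)))
     - 2 * int (card (components (negative_subgraph (seifert_graph D)))) + writhe D + 1"

end

theory Submission
  imports Defs
begin

text \<open>
  Let \<open>V\<close> be the number of Seifert circles and \<open>w\<close> the writhe.  A labelling of the Seifert
  circles by signs gives the tensor product of the \<open>x \<plusminus> 1\<close>; the canonical generator is the one
  with opposite signs at every crossing.

  Lower bound.  If the signs are opposite at all positive crossings, the product is a cocycle, and if
  moreover they agree at some negative crossing, it is a coboundary.  So reversing the signs on
  some, but not all, of the components of \<open>T\<^sup>+\<close> gives a cocycle that is cohomologous to zero, and
  the canonical generator is cohomologous to the product of its restriction to one component and of
  the differences of the two labellings of each of the other components.  The top term
  \<open>x \<otimes> \<dots> \<otimes> x\<close> cancels in each difference, hence the filtration degree is at least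
  \<open>w - V + 2 #T\<^sup>+ - 2\<close>.

  Upper bound.  Pairing with the product over the components of \<open>T\<^sup>-\<close> of the same differences kills
  all coboundaries and not the canonical generator, and it only sees terms with an \<open>x\<close> on every
  component of \<open>T\<^sup>-\<close>, hence the degree is at most \<open>w + V - 2 #T\<^sup>-\<close>.

  The two bounds agree as soon as \<open>#T\<^sup>+ + #T\<^sup>- \<ge> V + 1\<close>.  For an alternating diagram with
  \<open>n\<close> crossings the circles of the all-0 and of the all-1 resolution are the \<open>n + 2\<close> regions, and
  switching the smoothings of the positive, respectively negative, crossings one at a time bounds
  the number of these circles by \<open>n\<^sub>\<plusminus> - V + 2 #T\<^sup>\<plusminus>\<close>.
\<close>


section \<open>Classes of a generated equivalence relation\<close>

definition eqv :: "('a \<times> 'a) set \<Rightarrow> ('a \<times> 'a) set" where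
  "eqv r = (r \<union> r\<inverse>)\<^sup>*"

lemma eqv_refl: "(x, x) \<in> eqv r"
  by (simp add: eqv_def)

lemma eqv_sym: "(x, y) \<in> eqv r \<Longrightarrow> (y, x) \<in> eqv r"
  unfolding eqv_def by (metis converse_Un converse_converse rtrancl_converseI sup_commute)

lemma eqv_trans: "(x, y) \<in> eqv r \<Longrightarrow> (y, z) \<in> eqv r \<Longrightarrow> (x, z) \<in> eqv r"
  unfolding eqv_def by (rule rtrancl_trans)

lemma eqv_base: "(x, y) \<in> r \<Longrightarrow> (x, y) \<in> eqv r"
  by (auto simp: eqv_def)

lemma eqv_induct [consumes 1, case_names refl step]:
  assumes "(x, y) \<in> eqv r" "P x"
    and "\<And>y z. P y \<Longrightarrow> (y, z) \<in> r \<or> (z, y) \<in> r \<Longrightarrow> P z"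
  shows "P y"
  using assms(1) unfolding eqv_def
  by (induction rule: rtrancl_induct) (use assms in auto)

lemma eqv_mono:
  assumes "r \<subseteq> eqv r'"
  shows "eqv r \<subseteq> eqv r'"
proof clarify
  fix x y
  assume "(x, y) \<in> eqv r"
  then show "(x, y) \<in> eqv r'"
    by (induction rule: eqv_induct) (use assms in \<open>blast intro: eqv_refl eqv_trans eqv_sym\<close>)+
qed

lemma eqv_base': "(y, x) \<in> r \<Longrightarrow> (x, y) \<in> eqv r"
  by (auto simp: eqv_def)

lemma eqv_eqI: "s \<subseteq> eqv t \<Longrightarrow> t \<subseteq> eqv s \<Longrightarrow> eqv s = eqv t"
  by (intro equalityI eqv_mono)

lemma eqv_insert:
  \<comment> \<open>A connecting path can be shortened so that it uses the new pair at most once, in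
    one direction or the other.\<close>
  "(x, y) \<in> eqv (insert (a, b) r) \<longleftrightarrow>
    (x, y) \<in> eqv r \<or> (x, a) \<in> eqv r \<and> (b, y) \<in> eqv r \<or> (x, b) \<in> eqv r \<and> (a, y) \<in> eqv r"
  (is "?l \<longleftrightarrow> ?r y")
proof
  assume ?l
  then show "?r y"
  proof (induction rule: eqv_induct)
    case (step y z)
    then consider "(y, z) \<in> eqv r" | "y = a" "z = b" | "y = b" "z = a"
      by (auto intro: eqv_base eqv_sym)
    then show ?case
    proof cases
      case 1
      then show ?thesis
        using step.IH eqv_trans[OF _ 1] by blast
    qed (use step.IH eqv_refl[of a r] eqv_refl[of b r] in blast)+
  qed (simp add: eqv_refl)
next
  have "eqv r \<subseteq> eqv (insert (a, b) r)"
    by (intro eqv_mono) (auto intro: eqv_base)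
  moreover have "(a, b) \<in> eqv (insert (a, b) r)" "(b, a) \<in> eqv (insert (a, b) r)"
    by (auto intro: eqv_base eqv_sym)
  moreover assume "?r y"
  ultimately show ?l
    using eqv_trans[of x a "insert (a, b) r" b] eqv_trans[of x b "insert (a, b) r" a]
      eqv_trans[of x a "insert (a, b) r" y] eqv_trans[of x b "insert (a, b) r" y] by blast
qed

lemma eqv_insert_redundant:
  assumes "(a, b) \<in> eqv r"
  shows "eqv (insert (a, b) r) = eqv r"
proof
  show "eqv (insert (a, b) r) \<subseteq> eqv r"
    using assms by (intro eqv_mono) (auto intro: eqv_base)
  show "eqv r \<subseteq> eqv (insert (a, b) r)"
    by (intro eqv_mono) (auto intro: eqv_base)
qed

definition cls :: "'a set \<Rightarrow> ('a \<times> 'a) set \<Rightarrow> 'a \<Rightarrow> 'a set" where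
  "cls A r x = {y \<in> A. (x, y) \<in> eqv r}"

lemma classes_eq_image: "classes A r = cls A r ` A"
  by (auto simp: classes_def cls_def quotient_def eqv_def)

lemma cls_self: "x \<in> A \<Longrightarrow> x \<in> cls A r x"
  by (simp add: cls_def eqv_refl)

lemma cls_eq_iff:
  assumes "x \<in> A" "y \<in> A"
  shows "cls A r x = cls A r y \<longleftrightarrow> (x, y) \<in> eqv r"
proof
  assume "cls A r x = cls A r y"
  then have "y \<in> cls A r x"
    using assms by (simp add: cls_self)
  then show "(x, y) \<in> eqv r"
    by (simp add: cls_def)
next
  assume "(x, y) \<in> eqv r"
  then have "(x, z) \<in> eqv r \<longleftrightarrow> (y, z) \<in> eqv r" for z
    using eqv_trans[of x y r z] eqv_trans[of y x r z] eqv_sym[of x y r] by blast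
  then show "cls A r x = cls A r y"
    by (simp add: cls_def)
qed

lemma mem_cls_iff:
  assumes "x \<in> A"
  shows "y \<in> cls A r x \<longleftrightarrow> y \<in> A \<and> cls A r y = cls A r x"
  using assms cls_eq_iff[OF assms, of y r] by (auto simp: cls_def)

lemma cls_cong: "eqv r = eqv r' \<Longrightarrow> cls A r = cls A r'"
  by (simp add: cls_def fun_eq_iff)

lemma cls_insert:
  assumes "x \<in> A" "a \<in> A" "b \<in> A"
  shows "cls A (insert (a, b) r) x =
    (if cls A r x \<in> {cls A r a, cls A r b} then cls A r a \<union> cls A r b else cls A r x)"
proof -
  have "y \<in> cls A (insert (a, b) r) x \<longleftrightarrow> y \<in> A \<and>
      (cls A r x = cls A r y \<or> cls A r x = cls A r a \<and> cls A r b = cls A r y \<or>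
        cls A r x = cls A r b \<and> cls A r a = cls A r y)" for y
  proof (cases "y \<in> A")
    case True
    then show ?thesis
      using cls_eq_iff[OF assms(1) True] cls_eq_iff[OF assms(1,2)] cls_eq_iff[OF assms(1,3)]
        cls_eq_iff[OF assms(2) True] cls_eq_iff[OF assms(3) True]
      by (simp add: cls_def[of A "insert (a, b) r"] eqv_insert)
  qed (simp add: cls_def)
  \<comment> \<open>With arbitrary sets in place of the classes, the claim becomes a propositional
    case split.\<close>
  moreover have "y \<in> (if X \<in> {P, Q} then P \<union> Q else X) \<longleftrightarrow>
      y \<in> A \<and> (X = Y \<or> X = P \<and> Q = Y \<or> X = Q \<and> P = Y)"
    if "y \<in> X \<longleftrightarrow> y \<in> A \<and> Y = X" "y \<in> P \<longleftrightarrow> y \<in> A \<and> Y = P" "y \<in> Q \<longleftrightarrow> y \<in> A \<and> Y = Q"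
    for y X Y P Q
    using that by (cases "X = P"; cases "X = Q") auto
  ultimately show ?thesis
    using mem_cls_iff[OF assms(1), of _ r] mem_cls_iff[OF assms(2), of _ r] mem_cls_iff[OF assms(3), of _ r]
    by (intro set_eqI) presburger
qed

text \<open>Two classes are traded for their union. The union is not an old class: it contains
  \<open>a\<close>, so it would have to be the class of \<open>a\<close>.\<close>

lemma card_classes_merge:
  assumes "finite A" "a \<in> A" "b \<in> A" "cls A r a \<noteq> cls A r b"
  shows "card (classes A (insert (a, b) r)) + 1 = card (classes A r)"
proof -
  let ?C = "classes A r" and ?a = "cls A r a" and ?b = "cls A r b"
  have fin: "finite ?C"
    using assms by (simp add: classes_eq_image)
  have ab: "?a \<in> ?C" "?b \<in> ?C"
    using assms by (auto simp: classes_eq_image)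
  have new: "?a \<union> ?b \<notin> ?C - {?a, ?b}"
  proof
    assume "?a \<union> ?b \<in> ?C - {?a, ?b}"
    then obtain x where x: "x \<in> A" "cls A r x = ?a \<union> ?b" "cls A r x \<noteq> ?a"
      by (auto simp: classes_eq_image)
    then have "a \<in> cls A r x"
      using cls_self[OF assms(2), of r] by simp
    then show False
      using x(1,3) by (simp add: mem_cls_iff)
  qed
  have "classes A (insert (a, b) r) = insert (?a \<union> ?b) (?C - {?a, ?b})"
    using assms by (auto simp: classes_eq_image cls_insert)
  then have "card (classes A (insert (a, b) r)) = Suc (card (?C - {?a, ?b}))"
    using fin new by simp
  moreover have "card ?C = Suc (Suc (card (?C - {?a, ?b})))"
    using fin ab assms(4)
    by (metis Diff_insert card.remove finite_Diff finite_insert insert_Diff insert_iff)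
  ultimately show ?thesis
    by simp
qed

lemma card_classes_insert_ge:
  assumes "finite A" "a \<in> A" "b \<in> A"
  shows "card (classes A r) \<le> card (classes A (insert (a, b) r)) + 1"
proof (cases "cls A r a = cls A r b")
  case True
  then have "classes A (insert (a, b) r) = classes A r"
    using assms by (simp add: cls_eq_iff classes_eq_image cls_cong[OF eqv_insert_redundant])
  then show ?thesis
    by simp
qed (use card_classes_merge[OF assms] in simp)

text \<open>On \<open>A\<close> the map \<open>g\<close> factors through \<open>f\<close>, by means
  of chosen preimages.\<close>

lemma card_image_factor:
  assumes "finite A" "\<And>x y. x \<in> A \<Longrightarrow> y \<in> A \<Longrightarrow> f x = f y \<Longrightarrow> g x = g y"
  shows "card (g ` A) \<le> card (f ` A)"
proof -
  have "g (inv_into A f (f x)) = g x" if "x \<in> A" for x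
    using that by (intro assms(2)) (auto intro: inv_into_into f_inv_into_f)
  then have "g ` A = (\<lambda>z. g (inv_into A f z)) ` f ` A"
    unfolding image_image by (intro image_cong refl) (rule sym)
  then show ?thesis
    using card_image_le[of "f ` A" "\<lambda>z. g (inv_into A f z)"] assms(1) by simp
qed

lemma card_classes_antimono:
  assumes "finite A" "r \<subseteq> eqv r'"
  shows "card (classes A r') \<le> card (classes A r)"
  unfolding classes_eq_image
  using assms(1) by (rule card_image_factor) (use eqv_mono[OF assms(2)] in \<open>auto simp: cls_eq_iff\<close>)

section \<open>Circles of a resolution\<close>

definition links :: "diagram \<Rightarrow> nat set \<Rightarrow> (nat \<times> nat) set" where
  "links D S = (\<Union>i\<in>indices D. smoothing (crossings D ! i) (i \<in> S))"

definition circle :: "diagram \<Rightarrow> nat set \<Rightarrow> nat \<Rightarrow> nat set" where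
  "circle D S = cls (arcs D) (links D S)"

lemma circles_eq_image: "circles D S = circle D S ` arcs D"
  by (simp add: circles_def links_def circle_def classes_eq_image)

lemma finite_arcs: "finite (arcs D)"
  by (simp add: arcs_def)

lemma finite_indices: "finite (indices D)"
  by (simp add: indices_def)

lemma finite_circles: "finite (circles D S)"
  by (simp add: circles_eq_image finite_arcs)

text \<open>In both smoothings of a crossing, \<open>u_in\<close> and \<open>u_out\<close> are on different strands.\<close>

definition first_circle :: "diagram \<Rightarrow> nat set \<Rightarrow> nat \<Rightarrow> nat set" where
  "first_circle D S i = circle D S (u_in (crossings D ! i))"

definition second_circle :: "diagram \<Rightarrow> nat set \<Rightarrow> nat \<Rightarrow> nat set" where
  "second_circle D S i = circle D S (u_out (crossings D ! i))"

definition flip :: "nat set \<Rightarrow> nat \<Rightarrow> nat set" where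
  "flip S i = (if i \<in> S then S - {i} else insert i S)"

section \<open>Changing the smoothing at a single crossing\<close>

locale knot =
  fixes D :: diagram
  assumes knot: "knot_diagram D"
begin

abbreviation cr :: "nat \<Rightarrow> crossing" where
  "cr i \<equiv> crossings D ! i"

text \<open>There are as many slots as arcs, so distinct entries exhaust the arcs. The diagram
  without crossings is excluded, since its single closed arc fills no slot.\<close>

lemma sum_slots:
  fixes f :: "nat \<Rightarrow> nat"
  assumes "distinct (map g (crossings D) @ map h (crossings D))"
    and "set (map g (crossings D) @ map h (crossings D)) \<subseteq> arcs D"
    and "indices D \<noteq> {}"
  shows "(\<Sum>i\<in>indices D. f (g (cr i)) + f (h (cr i))) = sum f (arcs D)"
    and "g ` set (crossings D) \<union> h ` set (crossings D) = arcs D"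
proof -
  let ?xs = "map g (crossings D) @ map h (crossings D)"
  have "card (arcs D) = length ?xs"
    using assms(3) by (auto simp: arcs_def indices_def)
  then have set: "set ?xs = arcs D"
    using assms by (intro card_subset_eq) (simp_all only: finite_arcs distinct_card)
  then show "g ` set (crossings D) \<union> h ` set (crossings D) = arcs D"
    by simp
  have "sum f (arcs D) = sum_list (map f ?xs)"
    using assms(1) set by (metis sum_list_distinct_conv_sum_set)
  also have "\<dots> = (\<Sum>i\<in>indices D. f (g (cr i)) + f (h (cr i)))"
    by (simp only: map_append sum_list_append map_map)
      (simp add: sum_list_sum_nth indices_def atLeast0LessThan sum.distrib)
  finally show "(\<Sum>i\<in>indices D. f (g (cr i)) + f (h (cr i))) = sum f (arcs D)" ..
qed

lemmas sum_ins = sum_slots[of u_in o_in]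
lemmas sum_outs = sum_slots[of u_out o_out]

lemma ins_distinct: "distinct (map u_in (crossings D) @ map o_in (crossings D))"
  and ins_arcs: "set (map u_in (crossings D) @ map o_in (crossings D)) \<subseteq> arcs D"
  and outs_distinct: "distinct (map u_out (crossings D) @ map o_out (crossings D))"
  and outs_arcs: "set (map u_out (crossings D) @ map o_out (crossings D)) \<subseteq> arcs D"
  and strands: "\<forall>e\<in>arcs D. \<forall>f\<in>arcs D. (e, f) \<in> (strand_rel D)\<^sup>*"
  and card_regions: "card (regions D) = length (crossings D) + 2"
  and outer_arc: "fst (outer D) \<in> arcs D"
  using knot unfolding knot_diagram_def Let_def by blast+

lemma slot_arcs:
  assumes "i \<in> indices D"
  shows "u_in (cr i) \<in> arcs D" "o_in (cr i) \<in> arcs D" "u_out (cr i) \<in> arcs D" "o_out (cr i) \<in> arcs D"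
  using ins_arcs outs_arcs nth_mem[of i "crossings D"] assms by (auto simp: indices_def)

text \<open>Every arc has two ends, so the ends of arcs in \<open>K\<close> are even in number. Each
  crossing other than \<open>i\<close> joins its ends in pairs that \<open>K\<close> does not
  separate and contributes an even number, hence so does \<open>i\<close>.\<close>

lemma even_slots:
  assumes i: "i \<in> indices D"
    and K: "\<And>j e f. j \<in> indices D \<Longrightarrow> j \<noteq> i \<Longrightarrow> (e, f) \<in> smoothing (cr j) (j \<in> S) \<Longrightarrow> e \<in> K \<longleftrightarrow> f \<in> K"
  shows "even (of_bool (u_in (cr i) \<in> K) + of_bool (o_in (cr i) \<in> K) +
    of_bool (u_out (cr i) \<in> K) + of_bool (o_out (cr i) \<in> K) :: nat)"
proof -
  define f :: "nat \<Rightarrow> nat" where "f e = of_bool (e \<in> K)" for e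
  define g where "g j = (f (u_in (cr j)) + f (o_in (cr j))) + (f (u_out (cr j)) + f (o_out (cr j)))" for j
  have ne: "indices D \<noteq> {}"
    using i by auto
  have "sum g (indices D) = 2 * sum f (arcs D)"
    using sum_ins(1)[OF ins_distinct ins_arcs ne, of f] sum_outs(1)[OF outs_distinct outs_arcs ne, of f]
    unfolding g_def by (simp add: sum.distrib)
  moreover have "even (g j)" if "j \<in> indices D - {i}" for j
  proof (cases "pos (cr j) \<noteq> (j \<in> S)")
    case True
    then show ?thesis
      using that K[of j "u_in (cr j)" "o_out (cr j)"] K[of j "o_in (cr j)" "u_out (cr j)"]
      by (simp add: smoothing_def f_def g_def)
  next
    case False
    then show ?thesis
      using that K[of j "u_in (cr j)" "o_in (cr j)"] K[of j "u_out (cr j)" "o_out (cr j)"]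
      by (simp add: smoothing_def f_def g_def)
  qed
  then have "even (sum g (indices D - {i}))"
    by (rule dvd_sum)
  moreover have "sum g (indices D) = g i + sum g (indices D - {i})"
    using finite_indices i by (rule sum.remove)
  ultimately have "even (g i)"
    by (metis dvd_triv_left even_add)
  then show ?thesis
    unfolding g_def f_def by (simp only: add.assoc)
qed

text \<open>
  The relation \<open>r\<close> links arcs at the other crossings only.  By parity, none of its classes contains
  exactly one of the four arc ends at the crossing \<open>i\<close>; so if the two strands there belong to
  different circles, \<open>r\<close> already closes up each of them.
\<close>

lemma crossing_pairing:
  assumes i: "i \<in> indices D"
  obtains r b c where "b \<in> arcs D" "c \<in> arcs D"
    "eqv (links D S) = eqv (insert (u_in (cr i), b) (insert (c, u_out (cr i)) r))"
    "eqv (links D (flip S i)) = eqv (insert (u_in (cr i), c) (insert (b, u_out (cr i)) r))"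
    "first_circle D S i \<noteq> second_circle D S i \<Longrightarrow>
      (u_in (cr i), b) \<in> eqv r \<and> (c, u_out (cr i)) \<in> eqv r"
proof -
  define r where "r = (\<Union>j\<in>indices D - {i}. smoothing (cr j) (j \<in> S))"
  let ?a = "u_in (cr i)" and ?d = "u_out (cr i)" and ?or = "pos (cr i) \<noteq> (i \<in> S)"
  \<comment> \<open>The strand from \<open>u_in\<close> leads to \<open>b\<close> in the given
    smoothing and to \<open>c\<close> in the other one; \<open>u_out\<close> is joined to the
    remaining end.\<close>
  define b where "b = (if ?or then o_out (cr i) else o_in (cr i))"
  define c where "c = (if ?or then o_in (cr i) else o_out (cr i))"
  have arcs: "?a \<in> arcs D" "b \<in> arcs D" "c \<in> arcs D" "?d \<in> arcs D"
    using slot_arcs[OF i] by (auto simp: b_def c_def)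
  have links: "links D T = r \<union> smoothing (cr i) (i \<in> T)" if "\<And>j. j \<noteq> i \<Longrightarrow> j \<in> T \<longleftrightarrow> j \<in> S" for T
  proof -
    have "links D T = (\<Union>j\<in>insert i (indices D - {i}). smoothing (cr j) (j \<in> T))"
      using i by (simp add: links_def insert_absorb)
    moreover have "r = (\<Union>j\<in>indices D - {i}. smoothing (cr j) (j \<in> T))"
      unfolding r_def using that by (intro SUP_cong) auto
    ultimately show ?thesis
      by auto
  qed
  have S: "eqv (links D S) = eqv (insert (?a, b) (insert (c, ?d) r))"
    using links[of S] by (cases ?or) (auto simp: smoothing_def b_def c_def intro!: eqv_eqI intro: eqv_base eqv_base')
  have flip: "eqv (links D (flip S i)) = eqv (insert (?a, c) (insert (b, ?d) r))"
    using links[of "flip S i"]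
    by (cases ?or) (auto simp: flip_def smoothing_def b_def c_def intro!: eqv_eqI intro: eqv_base eqv_base' split: if_splits)
  have K: "even (of_bool (?a \<in> K) + of_bool (b \<in> K) + of_bool (c \<in> K) + of_bool (?d \<in> K) :: nat)"
    if "K = cls (arcs D) r x" for K x
  proof -
    have "e \<in> K \<longleftrightarrow> f \<in> K"
      if "j \<in> indices D" "j \<noteq> i" "(e, f) \<in> smoothing (cr j) (j \<in> S)" for j e f
    proof -
      have "(e, f) \<in> eqv r"
        using that by (intro eqv_base) (auto simp: r_def)
      moreover have "e \<in> arcs D" "f \<in> arcs D"
        using that slot_arcs[of j] by (auto simp: smoothing_def split: if_splits)
      ultimately show ?thesis
        using eqv_trans[of x e r f] eqv_trans[of x f r e] eqv_sym[of e f r]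
        by (auto simp: \<open>K = _\<close> cls_def)
    qed
    from even_slots[OF i this] show ?thesis
      by (simp add: b_def c_def add_ac)
  qed
  have "(?a, b) \<in> eqv r \<and> (c, ?d) \<in> eqv r" if "first_circle D S i \<noteq> second_circle D S i"
  proof -
    have neq: "(?a, ?d) \<notin> eqv (links D S)"
      using that arcs by (simp add: first_circle_def second_circle_def circle_def cls_eq_iff)
    have sub: "eqv r \<subseteq> eqv (links D S)"
      unfolding S by (intro eqv_mono) (auto intro: eqv_base)
    have ab: "(?a, b) \<in> eqv (links D S)" and cd: "(c, ?d) \<in> eqv (links D S)"
      unfolding S by (auto intro: eqv_base)
    \<comment> \<open>Each excluded pair would put \<open>u_in\<close> and \<open>u_out\<close> on
      one circle. What is left for the class of \<open>u_in\<close>, and likewise of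
      \<open>u_out\<close>, is its own partner, and parity forces that partner to be in it.\<close>
    have "(?a, ?d) \<notin> eqv r"
      using neq sub by blast
    moreover have "(?a, c) \<notin> eqv r"
      using neq sub eqv_trans[OF _ cd] by blast
    moreover have "(?d, b) \<notin> eqv r"
      using neq sub eqv_trans[OF ab, of ?d] eqv_sym[of ?d b r] by blast
    moreover have "(?d, ?a) \<notin> eqv r"
      using neq sub eqv_sym[of ?d ?a r] by blast
    ultimately have "(?a, b) \<in> eqv r" "(?d, c) \<in> eqv r"
      using K[OF refl, of ?a] K[OF refl, of ?d] arcs by (auto simp: cls_def eqv_refl split: if_splits)
    then show ?thesis
      using eqv_sym[of ?d c r] by blast
  qed
  then show thesis
    using that arcs S flip by blast
qed

text \<open>Both circles are already closed up away from \<open>i\<close>. The new smoothing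
  therefore amounts to the single link from \<open>u_in\<close> to \<open>c\<close>; its second link
  follows from the first.\<close>

lemma circle_flip:
  assumes i: "i \<in> indices D" and neq: "first_circle D S i \<noteq> second_circle D S i" and x: "x \<in> arcs D"
  shows "circle D (flip S i) x =
    (if circle D S x \<in> {first_circle D S i, second_circle D S i}
     then first_circle D S i \<union> second_circle D S i else circle D S x)"
proof -
  let ?a = "u_in (cr i)" and ?d = "u_out (cr i)"
  obtain r b c where arcs: "b \<in> arcs D" "c \<in> arcs D"
    and S: "eqv (links D S) = eqv (insert (?a, b) (insert (c, ?d) r))"
    and flip: "eqv (links D (flip S i)) = eqv (insert (?a, c) (insert (b, ?d) r))"
    and ab: "(?a, b) \<in> eqv r" and cd: "(c, ?d) \<in> eqv r"
    using crossing_pairing[OF i, of S] neq by metis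
  note ad = slot_arcs(1,3)[OF i]
  have "eqv (links D S) = eqv r"
    using ab cd by (simp add: S eqv_insert_redundant)
  then have circle: "circle D S = cls (arcs D) r"
    unfolding circle_def by (rule cls_cong)
  have sub: "eqv r \<subseteq> eqv (insert (?a, c) r)"
    by (intro eqv_mono) (auto intro: eqv_base)
  have "(b, ?a) \<in> eqv (insert (?a, c) r)" "(c, ?d) \<in> eqv (insert (?a, c) r)"
    using ab cd sub eqv_sym[of ?a b r] by auto
  moreover have "(?a, c) \<in> eqv (insert (?a, c) r)"
    by (simp add: eqv_base)
  ultimately have "(b, ?d) \<in> eqv (insert (?a, c) r)"
    using eqv_trans[of b ?a _ c] eqv_trans[of b c _ ?d] by simp
  then have "eqv (links D (flip S i)) = eqv (insert (?a, c) r)"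
    by (simp add: flip insert_commute[of "(?a, c)"] eqv_insert_redundant)
  then have "circle D (flip S i) x = cls (arcs D) (insert (?a, c) r) x"
    unfolding circle_def by (rule cls_cong[THEN fun_cong])
  moreover have "cls (arcs D) r c = cls (arcs D) r ?d"
    using cd arcs ad by (simp add: cls_eq_iff)
  ultimately show ?thesis
    using cls_insert[OF x ad(1) arcs(2), of r]
    by (simp add: first_circle_def second_circle_def circle)
qed

text \<open>Adding the old link from \<open>u_in\<close> to \<open>b\<close> to the flipped
  resolution gives a relation coarser than that of \<open>S\<close>, and one extra link loses at
  most one class.\<close>

lemma card_circles_flip_le:
  assumes i: "i \<in> indices D"
  shows "card (circles D (flip S i)) \<le> card (circles D S) + 1"
proof -
  let ?a = "u_in (cr i)" and ?d = "u_out (cr i)"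
  obtain r b c where arcs: "b \<in> arcs D" "c \<in> arcs D"
    and S: "eqv (links D S) = eqv (insert (?a, b) (insert (c, ?d) r))"
    and flip: "eqv (links D (flip S i)) = eqv (insert (?a, c) (insert (b, ?d) r))"
    using crossing_pairing[OF i, of S] by metis
  note ad = slot_arcs(1,3)[OF i]
  let ?r = "insert (?a, c) (insert (b, ?d) r)" and ?t = "insert (?a, b) (insert (?a, c) (insert (b, ?d) r))"
  have circles: "circles D T = classes (arcs D) t" if "eqv (links D T) = eqv t" for T t
    unfolding circles_eq_image circle_def cls_cong[OF that] classes_eq_image ..
  have "(c, ?a) \<in> eqv ?t" "(?a, b) \<in> eqv ?t" "(b, ?d) \<in> eqv ?t"
    by (auto intro: eqv_base eqv_base')
  then have "(c, ?d) \<in> eqv ?t"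
    using eqv_trans[of c ?a ?t b] eqv_trans[of c b ?t ?d] by simp
  then have "insert (?a, b) (insert (c, ?d) r) \<subseteq> eqv ?t"
    by (auto intro: eqv_base)
  then have "card (classes (arcs D) ?t) \<le> card (circles D S)"
    unfolding circles[OF S] by (intro card_classes_antimono finite_arcs)
  moreover have "card (circles D (flip S i)) \<le> card (classes (arcs D) ?t) + 1"
    unfolding circles[OF flip] using finite_arcs ad(1) arcs(1) by (rule card_classes_insert_ge)
  ultimately show ?thesis
    by simp
qed

lemma mem_circle_iff:
  assumes "x \<in> arcs D"
  shows "y \<in> circle D S x \<longleftrightarrow> y \<in> arcs D \<and> circle D S y = circle D S x"
  using mem_cls_iff[OF assms] by (simp add: circle_def)

lemma first_second_in_circles:
  assumes "i \<in> indices D"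
  shows "first_circle D S i \<in> circles D S" "second_circle D S i \<in> circles D S"
  using slot_arcs[OF assms] by (auto simp: first_circle_def second_circle_def circles_eq_image)

text \<open>Circles are sets of arcs, so it has to be ruled out that the merged circle is mistaken
  for an old one.\<close>

lemma merged_notin_circles:
  assumes i: "i \<in> indices D" and neq: "first_circle D S i \<noteq> second_circle D S i"
  shows "first_circle D S i \<union> second_circle D S i \<notin> circles D S"
proof
  assume "first_circle D S i \<union> second_circle D S i \<in> circles D S"
  then obtain x where x: "x \<in> arcs D" "circle D S x = first_circle D S i \<union> second_circle D S i"
    by (auto simp: circles_eq_image)
  note ad = slot_arcs(1,3)[OF i]
  have "u_in (cr i) \<in> circle D S x" "u_out (cr i) \<in> circle D S x"
    unfolding x(2) first_circle_def second_circle_def using ad by (simp_all add: circle_def cls_self)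
  then show False
    using neq x(1) by (simp add: mem_circle_iff first_circle_def second_circle_def)
qed

lemma circles_flip:
  assumes i: "i \<in> indices D" and neq: "first_circle D S i \<noteq> second_circle D S i"
  shows "circles D (flip S i) =
    insert (first_circle D S i \<union> second_circle D S i)
      (circles D S - {first_circle D S i, second_circle D S i})" (is "_ = insert (?p \<union> ?q) _")
proof -
  have "circles D (flip S i) = (\<lambda>C. if C \<in> {?p, ?q} then ?p \<union> ?q else C) ` circles D S"
    unfolding circles_eq_image image_image by (rule image_cong) (use circle_flip[OF assms] in auto)
  then show ?thesis
    using first_second_in_circles[OF i, of S] by auto
qed

lemma card_circles_flip_merge:
  assumes i: "i \<in> indices D" and neq: "first_circle D S i \<noteq> second_circle D S i"
  shows "card (circles D (flip S i)) + 1 = card (circles D S)"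
proof -
  let ?p = "first_circle D S i" and ?q = "second_circle D S i"
  have "card (circles D (flip S i)) = Suc (card (circles D S - {?p, ?q}))"
    unfolding circles_flip[OF assms] using finite_circles merged_notin_circles[OF assms]
    by (subst card_insert_disjoint) auto
  moreover have "card (circles D S) = card (circles D S - {?p, ?q}) + card {?p, ?q}"
    using first_second_in_circles[OF i] finite_circles by (metis card_Diff_subset card_mono empty_subsetI finite.emptyI finite_insert insert_subset le_add_diff_inverse2)
  ultimately show ?thesis
    using neq by simp
qed

end

section \<open>Counting circles and components\<close>

definition edge_rel :: "diagram \<Rightarrow> nat set \<Rightarrow> (nat set \<times> nat set) set" where
  "edge_rel D W = {(v, w). \<exists>i\<in>W. ends (seifert_graph D) i = {v, w}}"

text \<open>With the set of kept edges as a parameter, this covers \<open>T^+\<close>,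
  \<open>T^-\<close> and all the subgraphs between the edgeless one and these in the induction
  below.\<close>

definition comps :: "diagram \<Rightarrow> nat set \<Rightarrow> nat set set set" where
  "comps D W = classes (oriented_resolution D) (edge_rel D W)"

text \<open>The resolution that is oriented exactly at the crossings outside \<open>W\<close>.\<close>

definition switched :: "diagram \<Rightarrow> nat set \<Rightarrow> nat set" where
  "switched D W = (negatives D - W) \<union> (W - negatives D)"

lemma nodes_seifert_graph: "nodes (seifert_graph D) = oriented_resolution D"
  by (simp add: seifert_graph_def)

lemma components_negative_subgraph: "components (negative_subgraph (seifert_graph D)) = comps D (negatives D)"
  by (simp add: components_def negative_subgraph_def comps_def edge_rel_def seifert_graph_def
      negatives_def Let_def conj_commute)

lemma positives_negatives:
  "positives D \<union> negatives D = indices D" "positives D \<inter> negatives D = {}"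
  by (auto simp: positives_def negatives_def)

lemma card_positives_negatives: "card (positives D) + card (negatives D) = length (crossings D)"
proof -
  have "finite (positives D)" "finite (negatives D)"
    using positives_negatives(1)[of D] finite_indices[of D] by (metis finite_Un)+
  then have "card (positives D \<union> negatives D) = card (positives D) + card (negatives D)"
    using positives_negatives(2) by (rule card_Un_disjoint)
  then show ?thesis
    by (simp add: positives_negatives indices_def)
qed

lemma switched_insert: "i \<notin> W \<Longrightarrow> switched D (insert i W) = flip (switched D W) i"
  by (auto simp: switched_def flip_def)

lemma switched_empty: "switched D {} = negatives D"
  by (simp add: switched_def)

lemma switched_positives: "switched D (positives D) = indices D"
  using positives_negatives[of D] by (auto simp: switched_def)

lemma switched_negatives: "switched D (negatives D) = {}"
  by (simp add: switched_def)

context knot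
begin

abbreviation seifert :: "nat \<Rightarrow> nat set" where
  "seifert \<equiv> circle D (negatives D)"

abbreviation first :: "nat \<Rightarrow> nat set" where
  "first \<equiv> first_circle D (negatives D)"

abbreviation second :: "nat \<Rightarrow> nat set" where
  "second \<equiv> second_circle D (negatives D)"

lemma oriented_resolution_eq: "oriented_resolution D = seifert ` arcs D"
  by (simp add: oriented_resolution_def circles_eq_image)

lemma finite_oriented_resolution: "finite (oriented_resolution D)"
  by (simp add: oriented_resolution_def finite_circles)

lemma first_second_nodes:
  assumes "i \<in> indices D"
  shows "first i \<in> oriented_resolution D" "second i \<in> oriented_resolution D"
  using first_second_in_circles[OF assms] by (simp_all add: oriented_resolution_def)

lemma seifert_slots:
  assumes i: "i \<in> indices D"
  shows "seifert (u_in (cr i)) = first i" "seifert (o_out (cr i)) = first i"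
    "seifert (o_in (cr i)) = second i" "seifert (u_out (cr i)) = second i"
proof -
  have "{(u_in (cr i), o_out (cr i)), (o_in (cr i), u_out (cr i))} \<subseteq> links D (negatives D)"
    using i by (auto simp: links_def smoothing_def negatives_def intro!: bexI[of _ i])
  then have "(u_in (cr i), o_out (cr i)) \<in> eqv (links D (negatives D))"
    "(o_in (cr i), u_out (cr i)) \<in> eqv (links D (negatives D))"
    by (auto intro: eqv_base)
  then have "seifert (u_in (cr i)) = seifert (o_out (cr i))" "seifert (o_in (cr i)) = seifert (u_out (cr i))"
    using slot_arcs[OF i] by (simp_all add: circle_def cls_eq_iff)
  then show "seifert (u_in (cr i)) = first i" "seifert (o_out (cr i)) = first i"
    "seifert (o_in (cr i)) = second i" "seifert (u_out (cr i)) = second i"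
    by (simp_all add: first_circle_def second_circle_def)
qed

lemma ends_seifert_graph:
  assumes i: "i \<in> indices D"
  shows "ends (seifert_graph D) i = {first i, second i}"
proof -
  have *: "C \<inter> {u_in (cr i), u_out (cr i), o_in (cr i), o_out (cr i)} \<noteq> {} \<longleftrightarrow> C = first i \<or> C = second i"
    if C: "C \<in> oriented_resolution D" for C
  proof -
    obtain x where x: "x \<in> arcs D" "C = seifert x"
      using C by (auto simp: oriented_resolution_eq)
    have "e \<in> C \<longleftrightarrow> C = seifert e" if "e \<in> arcs D" for e
      using mem_circle_iff[OF x(1), of e] that by (auto simp: x(2))
    from this[OF slot_arcs(1)[OF i]] this[OF slot_arcs(2)[OF i]] this[OF slot_arcs(3)[OF i]] this[OF slot_arcs(4)[OF i]]
    show ?thesis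
      by (simp add: Int_insert_right seifert_slots[OF i])
  qed
  have "ends (seifert_graph D) i =
      {C \<in> oriented_resolution D. C \<inter> {u_in (cr i), u_out (cr i), o_in (cr i), o_out (cr i)} \<noteq> {}}"
    by (simp add: seifert_graph_def Let_def)
  also have "\<dots> = {C \<in> oriented_resolution D. C = first i \<or> C = second i}"
    by (intro Collect_cong conj_cong refl) (rule *)
  also have "\<dots> = {first i, second i}"
    using first_second_nodes[OF i] by blast
  finally show ?thesis .
qed

lemma edge_rel_insert:
  assumes "i \<in> indices D"
  shows "eqv (edge_rel D (insert i W)) = eqv (insert (first i, second i) (edge_rel D W))"
proof (rule eqv_eqI)
  show "edge_rel D (insert i W) \<subseteq> eqv (insert (first i, second i) (edge_rel D W))"
    using ends_seifert_graph[OF assms]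
    by (auto simp: edge_rel_def doubleton_eq_iff intro: eqv_base eqv_base')
  show "insert (first i, second i) (edge_rel D W) \<subseteq> eqv (edge_rel D (insert i W))"
    using ends_seifert_graph[OF assms] by (auto simp: edge_rel_def intro!: eqv_base)
qed

text \<open>A circle of the switched resolution stays on its Seifert circle at crossings outside
  \<open>W\<close> and can change it only along an edge in \<open>W\<close>, so it projects into one
  component.\<close>

lemma switched_connected:
  assumes W: "W \<subseteq> indices D" and xy: "(x, y) \<in> eqv (links D (switched D W))"
  shows "(seifert x, seifert y) \<in> eqv (edge_rel D W)"
  using xy
proof (induction rule: eqv_induct)
  case refl
  show ?case
    by (rule eqv_refl)
next
  case (step y z)
  have *: "(seifert y, seifert z) \<in> eqv (edge_rel D W)" if yz: "(y, z) \<in> links D (switched D W)" for y z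
  proof -
    obtain j where j: "j \<in> indices D" "(y, z) \<in> smoothing (cr j) (j \<in> switched D W)"
      using yz by (auto simp: links_def)
    show ?thesis
    proof (cases "j \<in> W")
      case True
      then have "(first j, second j) \<in> eqv (edge_rel D W)" "(second j, first j) \<in> eqv (edge_rel D W)"
        using ends_seifert_graph[OF j(1)] by (auto simp: edge_rel_def intro!: eqv_base)
      then show ?thesis
        using j seifert_slots[OF j(1)] by (auto simp: smoothing_def eqv_refl split: if_splits)
    next
      case False
      then have "pos (cr j) \<noteq> (j \<in> switched D W)"
        using j(1) by (auto simp: switched_def negatives_def)
      then have "seifert y = seifert z"
        using j seifert_slots[OF j(1)] by (auto simp: smoothing_def)
      then show ?thesis
        by (simp add: eqv_refl)
    qed
  qed
  have "(seifert y, seifert z) \<in> eqv (edge_rel D W)"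
    using step.hyps *[of y z] eqv_sym[OF *[of z y]] by blast
  then show ?case
    by (rule eqv_trans[OF step.IH])
qed

lemma card_comps_empty: "card (comps D {}) = card (oriented_resolution D)"
proof -
  have "eqv (edge_rel D {}) = Id"
    by (auto simp: edge_rel_def eqv_def)
  then have "comps D {} = (\<lambda>C. {C}) ` oriented_resolution D"
    unfolding comps_def classes_eq_image by (intro image_cong) (auto simp: cls_def)
  then show ?thesis
    by (simp add: card_image)
qed

text \<open>Induction on \<open>W\<close>, starting from equality. If switching \<open>i\<close>
  merges two circles, both sides allow for it: the left drops by 1, the right by at most 1.
  Otherwise the left grows by at most 1, and the components are unchanged because the ends of
  \<open>i\<close> were already connected, so the right grows by 1.\<close>

lemma card_circles_switched:
  assumes "W \<subseteq> indices D"
  shows "card (circles D (switched D W)) + card (oriented_resolution D) \<le> card W + 2 * card (comps D W)"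
  using finite_subset[OF assms finite_indices] assms
proof (induction rule: finite_induct)
  case empty
  show ?case
    by (simp add: switched_empty card_comps_empty flip: oriented_resolution_def)
next
  case (insert i W)
  let ?S = "switched D W" and ?O = "oriented_resolution D"
  have i: "i \<in> indices D" and W: "W \<subseteq> indices D"
    using insert.prems by auto
  have S: "switched D (insert i W) = flip ?S i"
    using insert.hyps(2) by (rule switched_insert)
  have comps: "comps D (insert i W) = classes ?O (insert (first i, second i) (edge_rel D W))"
    unfolding comps_def classes_eq_image cls_cong[OF edge_rel_insert[OF i]] ..
  have IH: "card (circles D ?S) + card ?O \<le> card W + 2 * card (comps D W)"
    using insert.IH W by blast
  have card: "card (insert i W) = card W + 1"
    using insert.hyps by simp
  show ?case
  proof (cases "first_circle D ?S i = second_circle D ?S i")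
    case True
    then have "(u_in (cr i), u_out (cr i)) \<in> eqv (links D ?S)"
      using slot_arcs[OF i] by (simp add: first_circle_def second_circle_def circle_def cls_eq_iff)
    then have "(first i, second i) \<in> eqv (edge_rel D W)"
      using switched_connected[OF W] by (simp add: first_circle_def second_circle_def)
    then have "comps D (insert i W) = comps D W"
      by (simp only: comps comps_def[of D W] classes_eq_image cls_cong[OF eqv_insert_redundant])
    then show ?thesis
      using IH card card_circles_flip_le[OF i, of ?S] by (simp add: S)
  next
    case False
    have "card (comps D W) \<le> card (comps D (insert i W)) + 1"
      unfolding comps unfolding comps_def
      using finite_oriented_resolution first_second_nodes[OF i] by (rule card_classes_insert_ge)
    then show ?thesis
      using IH card card_circles_flip_merge[OF i False] by (simp add: S)
  qed
qed

end

section \<open>Regions of an alternating diagram and the two extreme resolutions\<close>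

locale alternating_knot = knot +
  assumes alternating: "alternating D"
begin

text \<open>Arcs from an over-passage to an under-passage.\<close>

definition over :: "nat \<Rightarrow> bool" where
  "over e \<longleftrightarrow> e \<in> u_in ` set (crossings D)"

lemma over_slots:
  assumes "i \<in> indices D"
  shows "over (u_in (cr i))" "over (o_out (cr i))" "\<not> over (o_in (cr i))" "\<not> over (u_out (cr i))"
proof -
  have i: "cr i \<in> set (crossings D)"
    using assms by (simp add: indices_def)
  then show "over (u_in (cr i))" "over (o_out (cr i))"
    using alternating by (auto simp: over_def alternating_def)
  have disj: "u_in ` set (crossings D) \<inter> o_in ` set (crossings D) = {}"
    using ins_distinct by (auto simp: distinct_append)
  then show "\<not> over (o_in (cr i))"
    using i by (auto simp: over_def)
  have "u_out (cr i) \<in> o_in ` set (crossings D)"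
    using i alternating by (auto simp: alternating_def)
  then show "\<not> over (u_out (cr i))"
    using disj by (auto simp: over_def)
qed

text \<open>The two colours of the chequerboard colouring, as a choice of a side for each arc.\<close>

definition face :: "bool \<Rightarrow> nat \<Rightarrow> nat \<times> side" where
  "face one e = (e, if over e = one then L else R)"

text \<open>Alternation enters here: over-to-under arcs show a given colour on one side and the
  others on the opposite side, by the same rule at crossings of both signs.\<close>

lemma face_corners:
  assumes i: "i \<in> indices D" and xy: "(x, y) \<in> smoothing (cr i) one"
  shows "(face one x, face one y) \<in> corners (cr i) \<union> (corners (cr i))\<inverse>"
  using xy over_slots[OF i]
  by (cases one; cases "pos (cr i)") (auto simp: smoothing_def corners_def face_def Let_def)

text \<open>
  The regions of one colour are the circles of the all-0 resolution, those of the other colour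
  the circles of the all-1 resolution.
\<close>

lemma card_regions_le: "card (regions D) \<le> card (circles D (indices D)) + card (circles D {})"
proof -
  let ?R = "\<Union>c\<in>set (crossings D). corners c" and ?A = "arcs D \<times> (UNIV :: side set)"
  let ?st = "\<lambda>one. if one then indices D else {}"
  \<comment> \<open>A circle of the all-\<open>one\<close> resolution runs along a single region of
    the corresponding colour, so circles map onto the regions of that colour.\<close>
  have le: "card ((\<lambda>x. cls ?A ?R (face one x)) ` arcs D) \<le> card (circles D (?st one))" for one
    unfolding circles_eq_image using finite_arcs
  proof (rule card_image_factor)
    fix x y
    assume x: "x \<in> arcs D" and y: "y \<in> arcs D" and "circle D (?st one) x = circle D (?st one) y"
    then have "(x, y) \<in> eqv (links D (?st one))"
      by (simp add: circle_def cls_eq_iff)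
    then have "(face one x, face one y) \<in> eqv ?R"
    proof (induction rule: eqv_induct)
      case refl
      show ?case
        by (rule eqv_refl)
    next
      case (step y z)
      have *: "(face one y, face one z) \<in> eqv ?R" if yz: "(y, z) \<in> links D (?st one)" for y z
      proof -
        obtain j where j: "j \<in> indices D" "(y, z) \<in> smoothing (cr j) one"
          using yz by (auto simp: links_def split: if_splits)
        have "cr j \<in> set (crossings D)"
          using j(1) by (simp add: indices_def)
        then show ?thesis
          using face_corners[OF j] by (auto intro: eqv_base eqv_base')
      qed
      have "(face one y, face one z) \<in> eqv ?R"
        using step.hyps *[of y z] eqv_sym[OF *[of z y]] by blast
      then show ?case
        by (rule eqv_trans[OF step.IH])
    qed
    then show "cls ?A ?R (face one x) = cls ?A ?R (face one y)"
      using x y by (simp add: cls_eq_iff face_def)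
  qed
  have "\<exists>one. (e, s) = face one e" for e s
    by (cases s; cases "over e") (auto simp: face_def)
  then have "?A \<subseteq> face True ` arcs D \<union> face False ` arcs D"
    by (auto simp: image_iff) (metis (full_types))
  then have "cls ?A ?R ` ?A \<subseteq> cls ?A ?R ` (face True ` arcs D \<union> face False ` arcs D)"
    by (rule image_mono)
  then have "regions D \<subseteq> (\<lambda>x. cls ?A ?R (face True x)) ` arcs D \<union> (\<lambda>x. cls ?A ?R (face False x)) ` arcs D"
    by (simp only: regions_def classes_eq_image image_Un image_image)
  then have "card (regions D) \<le>
      card ((\<lambda>x. cls ?A ?R (face True x)) ` arcs D \<union> (\<lambda>x. cls ?A ?R (face False x)) ` arcs D)"
    by (intro card_mono) (auto simp: finite_arcs)
  also have "\<dots> \<le> card ((\<lambda>x. cls ?A ?R (face True x)) ` arcs D) + card ((\<lambda>x. cls ?A ?R (face False x)) ` arcs D)"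
    by (rule card_Un_le)
  finally show ?thesis
    using le[of True] le[of False] by simp
qed

text \<open>Add the circle bounds for the positive and the negative crossings. By Euler's formula
  the circles number at least \<open>n + 2\<close>; the \<open>n\<close> cancels and the rest is
  divided by 2.\<close>

lemma card_comps_ge:
  "card (oriented_resolution D) + 1 \<le> card (comps D (positives D)) + card (comps D (negatives D))"
proof -
  have "positives D \<subseteq> indices D" "negatives D \<subseteq> indices D"
    using positives_negatives(1) by auto
  from this[THEN card_circles_switched] show ?thesis
    using card_regions_le card_regions card_positives_negatives[of D]
    unfolding switched_positives switched_negatives by linarith
qed

end

section \<open>The canonical labelling\<close>

context alternating_knot
begin

section \<open>Chequerboard colourings\<close>

abbreviation corner_rel :: "((nat \<times> side) \<times> (nat \<times> side)) set" where
  "corner_rel \<equiv> \<Union>c\<in>set (crossings D). corners c"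

lemma region_of_eq:
  assumes p: "p \<in> arcs D \<times> UNIV"
  shows "region_of D p = cls (arcs D \<times> UNIV) corner_rel p"
  unfolding region_of_def
proof (rule the_equality)
  show "cls (arcs D \<times> UNIV) corner_rel p \<in> regions D \<and> p \<in> cls (arcs D \<times> UNIV) corner_rel p"
    using p cls_self[OF p] unfolding regions_def classes_eq_image by blast
next
  fix r
  assume r: "r \<in> regions D \<and> p \<in> r"
  then obtain q where q: "q \<in> arcs D \<times> UNIV" "r = cls (arcs D \<times> UNIV) corner_rel q"
    unfolding regions_def classes_eq_image by blast
  have "p \<in> cls (arcs D \<times> UNIV) corner_rel q"
    using r unfolding q(2) by blast
  then show "r = cls (arcs D \<times> UNIV) corner_rel p"
    unfolding q(2) mem_cls_iff[OF q(1)] by simp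
qed

lemma regions_eq: "regions D = region_of D ` (arcs D \<times> UNIV)"
  unfolding regions_def classes_eq_image by (intro image_cong refl) (rule region_of_eq[symmetric])

lemma region_of_corner:
  assumes i: "i \<in> indices D" and pq: "(p, q) \<in> corners (cr i)"
  shows "region_of D p = region_of D q"
proof -
  have p: "p \<in> arcs D \<times> UNIV" and q: "q \<in> arcs D \<times> UNIV"
    using pq slot_arcs[OF i] by (auto simp: corners_def Let_def)
  have "cr i \<in> set (crossings D)"
    using i by (simp add: indices_def)
  then have "(p, q) \<in> eqv corner_rel"
    using pq by (intro eqv_base) blast
  then show ?thesis
    unfolding region_of_eq[OF p] region_of_eq[OF q] cls_eq_iff[OF p q] .
qed

text \<open>The predicate under the description operator in \<open>black\<close>, isolated in order
  to prove existence and uniqueness.\<close>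

definition coloring :: "(nat \<times> side) set set \<Rightarrow> bool" where
  "coloring B \<longleftrightarrow> B \<subseteq> regions D \<and>
     (\<forall>e\<in>arcs D. (region_of D (e, L) \<in> B) \<noteq> (region_of D (e, R) \<in> B)) \<and>
     region_of D (outer D) \<notin> B"

text \<open>The colour changes across every arc and is constant at every corner. Both cyclic orders
  of the ends give the same pattern: left sides agree along a strand of the oriented smoothing and
  differ between its two strands.\<close>

lemma coloring_crossing:
  assumes B: "coloring B" and i: "i \<in> indices D"
  shows "region_of D (o_out (cr i), L) \<in> B \<longleftrightarrow> region_of D (u_in (cr i), L) \<in> B"
    and "region_of D (o_in (cr i), L) \<in> B \<longleftrightarrow> region_of D (u_in (cr i), L) \<notin> B"
    and "region_of D (u_out (cr i), L) \<in> B \<longleftrightarrow> region_of D (u_in (cr i), L) \<notin> B"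
proof -
  have R: "region_of D (e, R) \<in> B \<longleftrightarrow> region_of D (e, L) \<notin> B" if "e \<in> arcs D" for e
    using B that by (auto simp: coloring_def)
  let ?r = "\<lambda>e s. region_of D (e, s)" and ?c = "cr i"
  consider
    "?r (u_in ?c) L = ?r (o_in ?c) R" "?r (u_in ?c) R = ?r (o_out ?c) R" "?r (o_out ?c) L = ?r (u_out ?c) R"
  | "?r (u_in ?c) R = ?r (o_in ?c) L" "?r (u_in ?c) L = ?r (o_out ?c) L" "?r (o_out ?c) R = ?r (u_out ?c) L"
  proof (cases "pos ?c")
    case True
    show thesis
      by (rule that(1)) (rule region_of_corner[OF i], simp add: True corners_def Let_def)+
  next
    case False
    show thesis
      by (rule that(2)) (rule region_of_corner[OF i], simp add: False corners_def Let_def)+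
  qed
  then show "?r (o_out ?c) L \<in> B \<longleftrightarrow> ?r (u_in ?c) L \<in> B"
    and "?r (o_in ?c) L \<in> B \<longleftrightarrow> ?r (u_in ?c) L \<notin> B"
    and "?r (u_out ?c) L \<in> B \<longleftrightarrow> ?r (u_in ?c) L \<notin> B"
    by (cases; metis R slot_arcs[OF i])+
qed

text \<open>For an alternating diagram the colour of a side can be read off from whether its arc
  leads to an under-passage, so no planar separation argument enters.\<close>

lemma coloring_exists: "\<exists>B. coloring B"
proof -
  define dark where "dark p \<longleftrightarrow> (p = face True (fst p))" for p
  have corner: "dark p \<longleftrightarrow> dark q" if "(p, q) \<in> corner_rel" for p q
  proof -
    obtain i where i: "i \<in> indices D" "(p, q) \<in> corners (cr i)"
      using \<open>(p, q) \<in> corner_rel\<close> by (auto simp: in_set_conv_nth indices_def)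
    then show ?thesis
      using over_slots[OF i(1)] by (auto simp: corners_def dark_def face_def Let_def split: if_splits)
  qed
  have eqv: "dark p \<longleftrightarrow> dark q" if "(p, q) \<in> eqv corner_rel" for p q
    using that by (induction rule: eqv_induct) (use corner in blast)+
  \<comment> \<open>Comparison with the side \<open>outer D\<close> makes the unbounded region
    white.\<close>
  define B where "B = {r \<in> regions D. \<exists>p\<in>r. dark p \<noteq> dark (outer D)}"
  have mem: "region_of D p \<in> B \<longleftrightarrow> dark p \<noteq> dark (outer D)" if p: "p \<in> arcs D \<times> UNIV" for p
  proof -
    have "dark q \<longleftrightarrow> dark p" if "q \<in> region_of D p" for q
      using that eqv[of p q] unfolding region_of_eq[OF p] cls_def by blast
    moreover have "p \<in> region_of D p"
      unfolding region_of_eq[OF p] using p by (rule cls_self)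
    moreover have "region_of D p \<in> regions D"
      using p by (simp add: regions_eq)
    ultimately show ?thesis
      unfolding B_def by blast
  qed
  have "outer D \<in> arcs D \<times> UNIV"
    using outer_arc by (cases "outer D") simp
  moreover have "dark (e, L) \<noteq> dark (e, R)" for e
    by (simp add: dark_def face_def)
  ultimately have "coloring B"
    unfolding coloring_def using mem by (auto simp: B_def)
  then show ?thesis ..
qed

text \<open>Agreement at the outer side passes across arcs, and through each crossing along the
  strand; the knot has one component, so it reaches every arc.\<close>

lemma coloring_unique:
  assumes B: "coloring B" and B': "coloring B'"
  shows "B = B'"
proof -
  let ?same = "\<lambda>e. region_of D (e, L) \<in> B \<longleftrightarrow> region_of D (e, L) \<in> B'"
  have side: "(region_of D (e, s) \<in> B \<longleftrightarrow> region_of D (e, s) \<in> B') \<longleftrightarrow> ?same e" if "e \<in> arcs D" for e s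
    using that B B' unfolding coloring_def by (cases s) blast+
  have strand: "?same f" if "(e, f) \<in> (strand_rel D)\<^sup>*" "?same e" for e f
    using that
  proof (induction rule: rtrancl_induct)
    case (step y z)
    obtain c where "c \<in> set (crossings D)" "(y, z) \<in> {(u_in c, u_out c), (o_in c, o_out c)}"
      using step.hyps(2) by (auto simp: strand_rel_def)
    then obtain i where i: "i \<in> indices D" "(y, z) \<in> {(u_in (cr i), u_out (cr i)), (o_in (cr i), o_out (cr i))}"
      by (auto simp: in_set_conv_nth indices_def)
    then show ?case
      using coloring_crossing[OF B i(1)] coloring_crossing[OF B' i(1)] step.IH step.prems by auto
  qed
  obtain e s where out: "outer D = (e, s)"
    by (cases "outer D")
  have e: "e \<in> arcs D"
    using outer_arc out by simp
  have "region_of D (e, s) \<in> B \<longleftrightarrow> region_of D (e, s) \<in> B'"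
    using B B' unfolding coloring_def out by blast
  then have "?same f" if "f \<in> arcs D" for f
    using strand[of e f] strands e that side[OF e, of s] by blast
  then have "r \<in> B \<longleftrightarrow> r \<in> B'" if "r \<in> regions D" for r
    using that side unfolding regions_eq by blast
  moreover have "B \<subseteq> regions D" "B' \<subseteq> regions D"
    using B B' by (auto simp: coloring_def)
  ultimately show ?thesis
    by blast
qed

lemma coloring_black: "coloring (black D)"
proof -
  have "\<exists>!B. coloring B"
    using coloring_exists coloring_unique by blast
  then show ?thesis
    unfolding black_def coloring_def by (rule theI')
qed

text \<open>The colour to the left is constant along a Seifert circle, so any of its arcs can
  witness the existential in \<open>b_circles\<close>.\<close>

lemma b_circles_iff:
  assumes x: "x \<in> arcs D"
  shows "seifert x \<in> b_circles D \<longleftrightarrow> region_of D (x, L) \<in> black D"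
proof -
  have *: "region_of D (y, L) \<in> black D \<longleftrightarrow> region_of D (x, L) \<in> black D"
    if "(x, y) \<in> eqv (links D (negatives D))" for y
    using that
  proof (induction rule: eqv_induct)
    case (step y z)
    then obtain y' z' where yz: "{y', z'} = {y, z}" "(y', z') \<in> links D (negatives D)"
      by blast
    then obtain i where i: "i \<in> indices D" "(y', z') \<in> smoothing (cr i) (i \<in> negatives D)"
      by (auto simp: links_def)
    then have "(y', z') \<in> {(u_in (cr i), o_out (cr i)), (o_in (cr i), u_out (cr i))}"
      by (auto simp: smoothing_def negatives_def)
    then have "region_of D (y', L) \<in> black D \<longleftrightarrow> region_of D (z', L) \<in> black D"
      using coloring_crossing[OF coloring_black i(1)] by auto
    then show ?case
      using step.IH yz(1) by (auto simp: doubleton_eq_iff)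
  qed simp
  have "seifert x \<in> oriented_resolution D"
    using x by (simp add: oriented_resolution_eq)
  moreover have "x \<in> seifert x"
    using x by (simp add: circle_def cls_self)
  moreover have "region_of D (y, L) \<in> black D \<longleftrightarrow> region_of D (x, L) \<in> black D" if "y \<in> seifert x" for y
    using that by (intro *) (simp add: circle_def cls_def)
  ultimately show ?thesis
    unfolding b_circles_def by blast
qed

definition canonical_label :: "nat set \<Rightarrow> complex" where
  "canonical_label C = (if C \<in> b_circles D then - 1 else 1)"

lemma canonical_label_square: "canonical_label C * canonical_label C = 1"
  by (simp add: canonical_label_def)

text \<open>The two strands of the oriented smoothing have differently coloured regions to their
  left.\<close>

lemma canonical_label_crossing:
  assumes i: "i \<in> indices D"
  shows "canonical_label (second i) = - canonical_label (first i)"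
  using b_circles_iff[OF slot_arcs(1)[OF i]] b_circles_iff[OF slot_arcs(2)[OF i]]
    coloring_crossing(2)[OF coloring_black i]
  by (simp add: canonical_label_def seifert_slots[OF i])

end

section \<open>Lee's differential on labelled resolutions\<close>

text \<open>Only four sets \<open>A\<close> restrict to \<open>B\<close>, one for each labelling of
  \<open>p\<close> and \<open>q\<close>. The indicator has the shape that matrix entries take at a
  merge or split.\<close>

lemma sum_Pow_two:
  fixes f :: "'a set \<Rightarrow> complex"
  assumes fin: "finite P" and pq: "p \<in> P" "q \<in> P" "p \<noteq> q" and B: "B \<subseteq> P - {p, q}"
  shows "(\<Sum>A\<in>Pow P. (if A - {p, q} = B \<and> c (p \<in> A) (q \<in> A) then 1 else 0) * f A) =
    of_bool (c False False) * f B + of_bool (c True False) * f (insert p B) +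
    of_bool (c False True) * f (insert q B) + of_bool (c True True) * f (insert p (insert q B))"
proof -
  let ?g = "\<lambda>A. (if A - {p, q} = B \<and> c (p \<in> A) (q \<in> A) then 1 else 0) * f A"
  let ?Z = "{B, insert p B, insert q B, insert p (insert q B)}"
  have "A \<in> ?Z" if "A - {p, q} = B" for A
    using that by (cases "p \<in> A"; cases "q \<in> A") auto
  then have "sum ?g (Pow P) = sum ?g ?Z"
    using fin pq B by (intro sum.mono_neutral_right) auto
  moreover have "p \<notin> B" "q \<notin> B" "B - {p, q} = B"
    using B by auto
  moreover have "insert p B \<noteq> insert q B" "B \<noteq> insert p B" "B \<noteq> insert q B"
    "B \<noteq> insert p (insert q B)" "insert p B \<noteq> insert p (insert q B)" "insert q B \<noteq> insert p (insert q B)"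
    using \<open>p \<notin> B\<close> \<open>q \<notin> B\<close> pq(3) by auto
  ultimately show ?thesis
    using pq(3) by (simp add: insert_Diff_if of_bool_def)
qed

lemma sum_Pow_one:
  fixes f :: "'a set \<Rightarrow> complex"
  assumes fin: "finite Q" and r: "r \<in> Q" and B: "B \<subseteq> Q - {r}"
  shows "(\<Sum>A\<in>Pow Q. (if A - {r} = B \<and> c (r \<in> A) then 1 else 0) * f A) =
    of_bool (c False) * f B + of_bool (c True) * f (insert r B)"
proof -
  let ?g = "\<lambda>A. (if A - {r} = B \<and> c (r \<in> A) then 1 else 0) * f A"
  have "A \<in> {B, insert r B}" if "A - {r} = B" for A
    using that by (cases "r \<in> A") auto
  then have "sum ?g (Pow Q) = sum ?g {B, insert r B}"
    using fin r B by (intro sum.mono_neutral_right) auto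
  moreover have "r \<notin> B"
    using B by auto
  then have "B - {r} = B" "B \<noteq> insert r B"
    by auto
  ultimately show ?thesis
    using \<open>r \<notin> B\<close> by (simp add: of_bool_def)
qed

text \<open>With \<open>X\<close> read as 1 in Z/2, multiplication is addition of labels.\<close>

lemma gen_mul_eq: "label A' r = mul (label A p) (label A q) \<longleftrightarrow> (r \<in> A' \<longleftrightarrow> (p \<in> A) \<noteq> (q \<in> A))"
  by (simp add: label_def)

lemma gen_comul_mem: "(label A p, label A q) \<in> comul (label A' r) \<longleftrightarrow> (r \<in> A' \<longleftrightarrow> (p \<in> A \<longleftrightarrow> q \<in> A))"
  by (simp add: label_def)

lemma label_eq: "label A C = label A' C \<longleftrightarrow> (C \<in> A \<longleftrightarrow> C \<in> A')"
  by (simp add: label_def)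

text \<open>One configuration serves both directions: \<open>S\<close> to \<open>S'\<close> is a
  merge, and \<open>S'\<close> to \<open>S\<close> is a split.\<close>

lemma edge_coeff_merge:
  assumes pq: "p \<in> circles D S" "q \<in> circles D S" "p \<noteq> q" and r: "r \<notin> circles D S"
    and S': "circles D S' = insert r (circles D S - {p, q})"
    and A: "A \<subseteq> circles D S" "A' \<subseteq> circles D S'"
  shows "edge_coeff D (S, A) (S', A') =
      (if A - {p, q} = A' - {r} \<and> (r \<in> A' \<longleftrightarrow> (p \<in> A) \<noteq> (q \<in> A)) then 1 else 0)"
    and "edge_coeff D (S', A') (S, A) =
      (if A - {p, q} = A' - {r} \<and> (r \<in> A' \<longleftrightarrow> (p \<in> A \<longleftrightarrow> q \<in> A)) then 1 else 0)"
proof -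
  have old: "circles D S - circles D S' = {p, q}" and new: "circles D S' - circles D S = {r}"
    and common: "circles D S \<inter> circles D S' = circles D S - {p, q}"
    using pq r by (auto simp: S')
  have com: "(\<forall>C\<in>circles D S - {p, q}. C \<in> A \<longleftrightarrow> C \<in> A') \<longleftrightarrow> A - {p, q} = A' - {r}"
    using A r unfolding S' by blast
  have neq: "{p, q} \<noteq> {x}" "{x} \<noteq> {p, q}" for x
    using pq(3) by auto
  have mul: "(\<exists>x y z. {p, q} = {x, y} \<and> x \<noteq> y \<and> {r} = {z} \<and> label A' z = mul (label A x) (label A y)) \<longleftrightarrow>
      (r \<in> A' \<longleftrightarrow> (p \<in> A) \<noteq> (q \<in> A))"
    using pq(3) unfolding gen_mul_eq doubleton_eq_iff by blast
  have comul: "(\<exists>x y z. {r} = {z} \<and> {p, q} = {x, y} \<and> x \<noteq> y \<and> (label A x, label A y) \<in> comul (label A' z)) \<longleftrightarrow>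
      (r \<in> A' \<longleftrightarrow> (p \<in> A \<longleftrightarrow> q \<in> A))"
    using pq(3) unfolding gen_comul_mem doubleton_eq_iff by blast
  show "edge_coeff D (S, A) (S', A') =
      (if A - {p, q} = A' - {r} \<and> (r \<in> A' \<longleftrightarrow> (p \<in> A) \<noteq> (q \<in> A)) then 1 else 0)"
    unfolding edge_coeff_def Let_def prod.case old new common label_eq com mul
    by (simp add: neq)
  have com': "(\<forall>C\<in>circles D S - {p, q}. C \<in> A' \<longleftrightarrow> C \<in> A) \<longleftrightarrow> A - {p, q} = A' - {r}"
    unfolding com[symmetric] by (intro ball_cong refl) (rule eq_commute)
  show "edge_coeff D (S', A') (S, A) =
      (if A - {p, q} = A' - {r} \<and> (r \<in> A' \<longleftrightarrow> (p \<in> A \<longleftrightarrow> q \<in> A)) then 1 else 0)"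
    unfolding edge_coeff_def Let_def prod.case old new Int_commute[of "circles D S'"] common label_eq com' comul
    by (simp add: neq)
qed

text \<open>The tensor product over the circles of the resolution \<open>S\<close> of \<open>x + \<lambda>(C)\<close>.\<close>

definition labelled :: "diagram \<Rightarrow> nat set \<Rightarrow> (nat set \<Rightarrow> complex) \<Rightarrow> chain" where
  "labelled D S l = (\<lambda>(T, A). if T = S \<and> A \<subseteq> circles D S then \<Prod>C\<in>circles D S - A. l C else 0)"

lemma prod_two:
  fixes l :: "'a \<Rightarrow> complex"
  assumes fin: "finite P" and pq: "p \<in> P" "q \<in> P" "p \<noteq> q" and B: "B \<subseteq> P - {p, q}"
  shows "(\<Prod>C\<in>P - B. l C) = l p * l q * (\<Prod>C\<in>P - {p, q} - B. l C)"
    and "(\<Prod>C\<in>P - insert p B. l C) = l q * (\<Prod>C\<in>P - {p, q} - B. l C)"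
    and "(\<Prod>C\<in>P - insert q B. l C) = l p * (\<Prod>C\<in>P - {p, q} - B. l C)"
    and "(\<Prod>C\<in>P - insert p (insert q B). l C) = (\<Prod>C\<in>P - {p, q} - B. l C)"
proof -
  have "P - B = insert p (insert q (P - {p, q} - B))" "P - insert p B = insert q (P - {p, q} - B)"
    "P - insert q B = insert p (P - {p, q} - B)" "P - insert p (insert q B) = P - {p, q} - B"
    using pq B by auto
  then show "(\<Prod>C\<in>P - B. l C) = l p * l q * (\<Prod>C\<in>P - {p, q} - B. l C)"
    and "(\<Prod>C\<in>P - insert p B. l C) = l q * (\<Prod>C\<in>P - {p, q} - B. l C)"
    and "(\<Prod>C\<in>P - insert q B. l C) = l p * (\<Prod>C\<in>P - {p, q} - B. l C)"
    and "(\<Prod>C\<in>P - insert p (insert q B). l C) = (\<Prod>C\<in>P - {p, q} - B. l C)"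
    using fin pq(3) by (simp_all add: mult.assoc)
qed

text \<open>Multiplication kills \<open>(x + 1) \<otimes> (x - 1)\<close>.\<close>

lemma merge_labelled:
  assumes pq: "p \<in> circles D S" "q \<in> circles D S" "p \<noteq> q" and r: "r \<notin> circles D S"
    and S': "circles D S' = insert r (circles D S - {p, q})"
    and l: "l q = - l p" "l p * l p = 1" and A': "A' \<subseteq> circles D S'"
  shows "(\<Sum>A\<in>Pow (circles D S). edge_coeff D (S, A) (S', A') * labelled D S l (S, A)) = 0"
proof -
  let ?P = "circles D S" and ?B = "A' - {r}"
  have B: "?B \<subseteq> ?P - {p, q}"
    using A' by (auto simp: S')
  have "(\<Sum>A\<in>Pow ?P. edge_coeff D (S, A) (S', A') * labelled D S l (S, A)) =
      (\<Sum>A\<in>Pow ?P. (if A - {p, q} = ?B \<and> (r \<in> A' \<longleftrightarrow> (p \<in> A) \<noteq> (q \<in> A)) then 1 else 0) * (\<Prod>C\<in>?P - A. l C))"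
    using edge_coeff_merge(1)[OF pq r S' _ A'] by (intro sum.cong refl) (simp add: labelled_def)
  also have "\<dots> = 0"
    unfolding sum_Pow_two[OF finite_circles pq B, where c = "\<lambda>x y. r \<in> A' \<longleftrightarrow> x \<noteq> y"]
      prod_two[OF finite_circles pq B]
    using l by (cases "r \<in> A'") (simp_all add: algebra_simps)
  finally show ?thesis .
qed

text \<open>Comultiplication sends \<open>x + \<lambda>\<close> to \<open>(x + \<lambda>) \<otimes> (x + \<lambda>)\<close> for \<open>\<lambda> = \<plusminus>1\<close>.\<close>

lemma split_labelled:
  assumes pq: "p \<in> circles D S" "q \<in> circles D S" "p \<noteq> q" and r: "r \<notin> circles D S"
    and S': "circles D S' = insert r (circles D S - {p, q})"
    and l: "l q = l p" "l p * l p = 1" and A: "A \<subseteq> circles D S"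
  shows "(\<Sum>A'\<in>Pow (circles D S'). edge_coeff D (S', A') (S, A) * labelled D S' (l(r := l p)) (S', A')) =
    labelled D S l (S, A)"
proof -
  let ?P = "circles D S" and ?Q = "circles D S'" and ?B = "A - {p, q}"
  let ?w = "\<Prod>C\<in>?P - {p, q} - ?B. l C"
  have B: "?B \<subseteq> ?Q - {r}" "?B \<subseteq> ?P - {p, q}"
    using A r by (auto simp: S')
  have rQ: "r \<in> ?Q"
    by (simp add: S')
  have "(\<Sum>A'\<in>Pow ?Q. edge_coeff D (S', A') (S, A) * labelled D S' (l(r := l p)) (S', A')) =
      (\<Sum>A'\<in>Pow ?Q. (if A' - {r} = ?B \<and> (r \<in> A' \<longleftrightarrow> (p \<in> A \<longleftrightarrow> q \<in> A)) then 1 else 0) *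
        (\<Prod>C\<in>?Q - A'. (l(r := l p)) C))"
    using edge_coeff_merge(2)[OF pq r S' A] by (intro sum.cong refl) (auto simp: labelled_def)
  also have "\<dots> = of_bool (\<not> (p \<in> A \<longleftrightarrow> q \<in> A)) * (\<Prod>C\<in>?Q - ?B. (l(r := l p)) C) +
      of_bool (p \<in> A \<longleftrightarrow> q \<in> A) * (\<Prod>C\<in>?Q - insert r ?B. (l(r := l p)) C)"
    unfolding sum_Pow_one[OF finite_circles rQ B(1), where c = "\<lambda>x. x \<longleftrightarrow> (p \<in> A \<longleftrightarrow> q \<in> A)"] by simp
  also have "(\<Prod>C\<in>?Q - insert r ?B. (l(r := l p)) C) = ?w"
    using r by (intro prod.cong) (auto simp: S')
  also have "(\<Prod>C\<in>?Q - ?B. (l(r := l p)) C) = l p * ?w"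
  proof -
    have "?Q - ?B = insert r (?P - {p, q} - ?B)"
      using B r by (auto simp: S')
    moreover have "(\<Prod>C\<in>?P - {p, q} - ?B. (l(r := l p)) C) = ?w"
      using r by (intro prod.cong) auto
    ultimately show ?thesis
      using r by (simp add: finite_circles)
  qed
  \<comment> \<open>Two circles labelled 1 contribute \<open>l p * l q = 1\<close>, just as two
    circles labelled x do; a mixed pair contributes \<open>l p\<close>.\<close>
  also have "of_bool (\<not> (p \<in> A \<longleftrightarrow> q \<in> A)) * (l p * ?w) + of_bool (p \<in> A \<longleftrightarrow> q \<in> A) * ?w = (\<Prod>C\<in>?P - A. l C)"
  proof -
    have "A = (if p \<in> A then if q \<in> A then insert p (insert q ?B) else insert p ?B
        else if q \<in> A then insert q ?B else ?B)"
      by auto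
    moreover have "l p * (l p * z) = z" for z
      using l(2) by (simp flip: mult.assoc)
    ultimately show ?thesis
      using prod_two[OF finite_circles pq B(2), of l] l(1)
      by (cases "p \<in> A"; cases "q \<in> A") simp_all
  qed
  also have "\<dots> = labelled D S l (S, A)"
    using A by (simp add: labelled_def)
  finally show ?thesis .
qed

text \<open>The dual of \<open>merge_labelled\<close>: comultiplication is the transpose of multiplication for
  the pairing \<open>\<epsilon>(a b)\<close>.\<close>

lemma split_pairing:
  assumes pq: "p \<in> circles D S" "q \<in> circles D S" "p \<noteq> q" and r: "r \<notin> circles D S"
    and S': "circles D S' = insert r (circles D S - {p, q})"
    and l: "l q = - l p" "l p * l p = 1" and A': "A' \<subseteq> circles D S'"
  shows "(\<Sum>A\<in>Pow (circles D S). edge_coeff D (S', A') (S, A) * (\<Prod>C\<in>A. l C)) = 0"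
proof -
  let ?P = "circles D S" and ?B = "A' - {r}"
  have B: "?B \<subseteq> ?P - {p, q}"
    using A' by (auto simp: S')
  have fin: "finite ?B"
    using B finite_circles[of D S] by (meson finite_Diff finite_subset)
  have notin: "p \<notin> ?B" "q \<notin> ?B"
    using B by auto
  have "(\<Sum>A\<in>Pow ?P. edge_coeff D (S', A') (S, A) * (\<Prod>C\<in>A. l C)) =
      (\<Sum>A\<in>Pow ?P. (if A - {p, q} = ?B \<and> (r \<in> A' \<longleftrightarrow> (p \<in> A \<longleftrightarrow> q \<in> A)) then 1 else 0) * (\<Prod>C\<in>A. l C))"
    using edge_coeff_merge(2)[OF pq r S' _ A'] by (intro sum.cong refl) simp
  also have "\<dots> = 0"
    unfolding sum_Pow_two[OF finite_circles pq B, where c = "\<lambda>x y. r \<in> A' \<longleftrightarrow> (x \<longleftrightarrow> y)"]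
    using l fin notin pq(3) by (cases "r \<in> A'") (simp_all add: algebra_simps flip: mult.assoc)
  finally show ?thesis .
qed

section \<open>Linearity of the differential and cohomologous chains\<close>

lemma lee_d_add: "lee_d D (\<lambda>s. f s + g s) = (\<lambda>s. lee_d D f s + lee_d D g s)"
  by (auto simp: lee_d_def fun_eq_iff distrib_left sum.distrib)

lemma lee_d_scale: "lee_d D (\<lambda>s. c * f s) = (\<lambda>s. c * lee_d D f s)"
  by (auto simp: lee_d_def fun_eq_iff sum_distrib_left mult_ac)

lemma lee_d_zero: "lee_d D (\<lambda>_. 0) = (\<lambda>_. 0)"
  by (auto simp: lee_d_def fun_eq_iff)

lemma lee_d_sum:
  assumes "finite K"
  shows "lee_d D (\<lambda>s. \<Sum>k\<in>K. c k * f k s) = (\<lambda>s. \<Sum>k\<in>K. c k * lee_d D (f k) s)"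
  using assms
proof (induction rule: finite_induct)
  case (insert k K)
  then show ?case
    using lee_d_add[of D "\<lambda>s. c k * f k s" "\<lambda>s. \<Sum>k\<in>K. c k * f k s"] lee_d_scale[of D "c k" "f k"]
    by simp
qed (simp add: lee_d_zero)

lemma chains_add: "f \<in> chains D i \<Longrightarrow> g \<in> chains D i \<Longrightarrow> (\<lambda>s. f s + g s) \<in> chains D i"
  unfolding chains_def mem_Collect_eq by (metis add_0)

lemma chains_scale: "f \<in> chains D i \<Longrightarrow> (\<lambda>s. c * f s) \<in> chains D i"
  by (simp add: chains_def)

lemma chains_sum:
  assumes "finite K" "\<And>k. k \<in> K \<Longrightarrow> f k \<in> chains D i"
  shows "(\<lambda>s. \<Sum>k\<in>K. c k * f k s) \<in> chains D i"
  using assms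
proof (induction rule: finite_induct)
  case empty
  show ?case
    by (simp add: chains_def)
next
  case (insert k K)
  then have "(\<lambda>s. c k * f k s + (\<Sum>k\<in>K. c k * f k s)) \<in> chains D i"
    by (intro chains_add chains_scale) auto
  then show ?case
    using insert.hyps by simp
qed

lemma cohomology_class_eqI:
  assumes b: "b \<in> chains D (i - 1)" and g: "g = (\<lambda>s. f s + lee_d D b s)"
  shows "cohomology_class D i g = cohomology_class D i f"
proof -
  have "(\<lambda>s. g s + lee_d D c s) \<in> cohomology_class D i f" if "c \<in> chains D (i - 1)" for c
    unfolding cohomology_class_def
    using chains_add[OF b that] lee_d_add[of D b c] by (auto simp: g add.assoc intro!: bexI)
  moreover have "(\<lambda>s. f s + lee_d D c s) \<in> cohomology_class D i g" if c: "c \<in> chains D (i - 1)" for c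
  proof -
    have "(\<lambda>s. c s + - 1 * b s) \<in> chains D (i - 1)"
      by (intro chains_add chains_scale b c)
    moreover have "lee_d D (\<lambda>s. c s + - 1 * b s) = (\<lambda>s. lee_d D c s + - 1 * lee_d D b s)"
      unfolding lee_d_add lee_d_scale ..
    ultimately show ?thesis
      unfolding cohomology_class_def by (auto simp: g intro!: bexI)
  qed
  ultimately show ?thesis
    unfolding cohomology_class_def by blast
qed

lemma labelled_chains:
  assumes "S \<subseteq> indices D" "int (card S) - int (card (negatives D)) = i"
  shows "labelled D S l \<in> chains D i"
  using assms by (auto simp: chains_def labelled_def states_def hdeg_def split: if_splits)

text \<open>The chain is supported on the single resolution \<open>S\<close>, so at most one edge of
  the cube contributes at \<open>S'\<close>, and its sign factors out.\<close>

lemma lee_d_labelled: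
  assumes "(S', A') \<in> states D"
  shows "lee_d D (labelled D S l) (S', A') =
    (if \<exists>i. i \<notin> S \<and> S' = insert i S
     then (-1) ^ card {k \<in> S'. k < (THE i. i \<notin> S \<and> S' = insert i S)} *
       (\<Sum>A\<in>Pow (circles D S). edge_coeff D (S, A) (S', A') * labelled D S l (S, A))
     else 0)"
proof -
  let ?t = "\<lambda>i. \<Sum>A\<in>Pow (circles D (S' - {i})). (-1) ^ card {k \<in> S'. k < i} *
      edge_coeff D (S' - {i}, A) (S', A') * labelled D S l (S' - {i}, A)"
  have d: "lee_d D (labelled D S l) (S', A') = sum ?t S'"
    using assms by (simp add: lee_d_def)
  have zero: "?t i = 0" if "S' - {i} \<noteq> S" for i
    using that by (simp add: labelled_def)
  have fin: "finite S'"
    using assms finite_subset[OF _ finite_indices] by (auto simp: states_def)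
  show ?thesis
  proof (cases "\<exists>i. i \<notin> S \<and> S' = insert i S")
    case True
    then obtain i where i: "i \<notin> S" "S' = insert i S"
      by blast
    have "j = i" if "S' - {j} = S" "j \<in> S'" for j
      using that i by blast
    then have "sum ?t S' = sum ?t {i}"
      using fin i zero by (intro sum.mono_neutral_right) auto
    moreover have "(THE j. j \<notin> S \<and> S' = insert j S) = i"
      using i by (intro the_equality) auto
    moreover have "S' - {i} = S"
      using i by auto
    ultimately show ?thesis
      using True by (simp add: d sum_distrib_left mult.assoc)
  next
    case False
    have "S' - {j} \<noteq> S" if "j \<in> S'" for j
      using that False by blast
    then have "sum ?t S' = 0"
      using zero by (intro sum.neutral) blast
    then show ?thesis
      by (simp only: d False if_False)
  qed
qed

section \<open>Signed sums over the components of a subgraph\<close>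

text \<open>Inserting \<open>x\<close> pairs off the subsets with opposite signs.\<close>

lemma alternating_sum_Pow_eq_0:
  fixes f :: "'a set \<Rightarrow> complex"
  assumes fin: "finite K" and x: "x \<in> K" and f: "\<And>F. F \<subseteq> K - {x} \<Longrightarrow> f (insert x F) = f F"
  shows "(\<Sum>F\<in>Pow K. (-1) ^ card F * f F) = 0"
proof -
  let ?Y = "K - {x}"
  let ?g = "\<lambda>F. (-1) ^ card F * f F"
  have "Pow K = Pow ?Y \<union> insert x ` Pow ?Y"
    using Pow_insert[of x ?Y] x by (simp add: insert_absorb)
  then have "sum ?g (Pow K) = sum ?g (Pow ?Y) + sum ?g (insert x ` Pow ?Y)"
    using fin by (simp only:) (intro sum.union_disjoint, auto)
  also have "sum ?g (insert x ` Pow ?Y) = (\<Sum>F\<in>Pow ?Y. ?g (insert x F))"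
    by (subst sum.reindex) (auto simp: inj_on_def)
  also have "\<dots> = (\<Sum>F\<in>Pow ?Y. - ?g F)"
  proof (intro sum.cong refl)
    fix F
    assume F: "F \<in> Pow ?Y"
    then have "finite F" "x \<notin> F"
      using fin by (auto intro: finite_subset)
    then show "?g (insert x F) = - ?g F"
      using f F by simp
  qed
  finally show ?thesis
    by (simp add: sum_negf)
qed

context alternating_knot
begin

definition flipped :: "nat set set set \<Rightarrow> nat set \<Rightarrow> complex" where
  "flipped F C = (if C \<in> \<Union>F then - canonical_label C else canonical_label C)"

lemma flipped_square: "flipped F C * flipped F C = 1"
  by (simp add: flipped_def canonical_label_square)

lemma finite_comps: "finite (comps D W)"
  by (simp add: comps_def classes_eq_image finite_oriented_resolution)

lemma comps_eq_cls:
  assumes "Q \<in> comps D W" "C \<in> Q"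
  shows "C \<in> oriented_resolution D" "Q = cls (oriented_resolution D) (edge_rel D W) C"
proof -
  obtain C' where C': "C' \<in> oriented_resolution D" "Q = cls (oriented_resolution D) (edge_rel D W) C'"
    using assms(1) unfolding comps_def classes_eq_image by blast
  have "C \<in> cls (oriented_resolution D) (edge_rel D W) C'"
    using assms(2) unfolding C'(2) .
  then show "C \<in> oriented_resolution D" "Q = cls (oriented_resolution D) (edge_rel D W) C"
    unfolding C'(2) mem_cls_iff[OF C'(1)] by simp_all
qed

lemma Union_comps_edge:
  assumes F: "F \<subseteq> comps D W" and i: "i \<in> W" "i \<in> indices D"
  shows "first i \<in> \<Union>F \<longleftrightarrow> second i \<in> \<Union>F"
proof -
  have "(first i, second i) \<in> edge_rel D W"
    using i ends_seifert_graph[OF i(2)] by (auto simp: edge_rel_def)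
  then have eq: "cls (oriented_resolution D) (edge_rel D W) (first i) =
      cls (oriented_resolution D) (edge_rel D W) (second i)"
    unfolding cls_eq_iff[OF first_second_nodes[OF i(2)]] by (rule eqv_base)
  have "second i \<in> Q" if "first i \<in> Q" "Q \<in> comps D W" for Q
    using comps_eq_cls(2)[OF that(2,1)] eq cls_self[OF first_second_nodes(2)[OF i(2)]] by metis
  moreover have "first i \<in> Q" if "second i \<in> Q" "Q \<in> comps D W" for Q
    using comps_eq_cls(2)[OF that(2,1)] eq cls_self[OF first_second_nodes(1)[OF i(2)]] by metis
  ultimately show ?thesis
    using F by blast
qed

text \<open>An edge in \<open>W\<close> has both ends in one component, so its two signs are
  reversed together or not at all.\<close>

lemma flipped_crossing:
  assumes "F \<subseteq> comps D W" "i \<in> W" "i \<in> indices D"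
  shows "flipped F (second i) = - flipped F (first i)"
  using Union_comps_edge[OF assms] canonical_label_crossing[OF assms(3)] by (simp add: flipped_def)

lemma flipped_insert_disjoint:
  assumes "F \<subseteq> comps D W" "Q \<in> comps D W" "Q \<inter> Z = {}"
  shows "(\<Prod>C\<in>Z. flipped (insert Q F) C) = (\<Prod>C\<in>Z. flipped F C)"
  using assms by (intro prod.cong) (auto simp: flipped_def)

text \<open>If a component in \<open>K\<close> misses \<open>Z\<close>, reversing it does not affect
  the product and the sum cancels. A nonzero sum thus needs a circle of \<open>Z\<close> in each of
  these disjoint components. \<open>Z\<close> will be the circles labelled 1 for the lower bound and
  those labelled x for the upper one.\<close>

lemma flipped_sum_support:
  assumes K: "K \<subseteq> comps D W" and Z: "finite Z"
    and nz: "(\<Sum>F\<in>Pow K. (-1) ^ card F * (\<Prod>C\<in>Z. flipped F C)) \<noteq> 0"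
  shows "card K \<le> card Z"
proof -
  have fin: "finite K"
    using K finite_comps by (rule finite_subset)
  have "Q \<in> cls (oriented_resolution D) (edge_rel D W) ` Z" if Q: "Q \<in> K" for Q
  proof -
    have "Q \<inter> Z \<noteq> {}"
    proof
      assume disj: "Q \<inter> Z = {}"
      have "(\<Sum>F\<in>Pow K. (-1) ^ card F * (\<Prod>C\<in>Z. flipped F C)) = 0"
        using fin Q by (rule alternating_sum_Pow_eq_0) (use K Q disj in \<open>blast intro: flipped_insert_disjoint\<close>)
      then show False
        using nz by simp
    qed
    then obtain C where "C \<in> Q" "C \<in> Z"
      by blast
    then show ?thesis
      using comps_eq_cls(2)[of Q W C] K Q by blast
  qed
  then have "K \<subseteq> cls (oriented_resolution D) (edge_rel D W) ` Z"
    by blast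
  then show ?thesis
    using Z by (meson card_image_le card_mono finite_imageI order_trans)
qed

lemma canonical_generator_eq: "canonical_generator D = labelled D (negatives D) canonical_label"
proof -
  have "(\<Prod>C\<in>oriented_resolution D. if C \<in> A then 1 else if C \<in> b_circles D then -1 else 1) =
      (\<Prod>C\<in>oriented_resolution D - A. canonical_label C)" for A
    using finite_oriented_resolution
    by (intro prod.mono_neutral_cong_right) (auto simp: canonical_label_def)
  then show ?thesis
    by (auto simp: canonical_generator_def labelled_def fun_eq_iff simp flip: oriented_resolution_def)
qed

end

section \<open>Bounds for the filtration degree\<close>

context alternating_knot
begin

section \<open>Cocycles and coboundaries given by signs on the Seifert circles\<close>

lemma negatives_subset: "negatives D \<subseteq> indices D"
  by (auto simp: negatives_def)

lemma finite_negatives: "finite (negatives D)"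
  using negatives_subset finite_indices by (rule finite_subset)

lemma merge_labelled_crossing:
  assumes i: "i \<in> indices D" "i \<notin> S"
    and l: "l (second_circle D S i) = - l (first_circle D S i)"
      "l (first_circle D S i) * l (first_circle D S i) = 1"
    and A': "A' \<subseteq> circles D (insert i S)"
  shows "(\<Sum>A\<in>Pow (circles D S). edge_coeff D (S, A) (insert i S, A') * labelled D S l (S, A)) = 0"
proof -
  have neq: "first_circle D S i \<noteq> second_circle D S i"
    using l by auto
  have "flip S i = insert i S"
    using i(2) by (simp add: flip_def)
  then show ?thesis
    using merge_labelled[OF first_second_in_circles[OF i(1)] neq merged_notin_circles[OF i(1) neq] _ l A']
      circles_flip[OF i(1) neq] by simp
qed

text \<open>Every edge of the cube leaving the oriented resolution adds a positive crossing; there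
  it merges circles with opposite signs and gives zero.\<close>

lemma labelled_cocycle:
  assumes sq: "\<And>C. l C * l C = 1"
    and l: "\<And>i. i \<in> positives D \<Longrightarrow> l (second i) = - l (first i)"
  shows "lee_d D (labelled D (negatives D) l) = (\<lambda>_. 0)"
proof (rule ext)
  fix s :: state
  obtain S' A' where s: "s = (S', A')"
    by (cases s)
  show "lee_d D (labelled D (negatives D) l) s = 0"
  proof (cases "(S', A') \<in> states D \<and> (\<exists>i. i \<notin> negatives D \<and> S' = insert i (negatives D))")
    case True
    then obtain i where i: "i \<notin> negatives D" "S' = insert i (negatives D)"
      and A': "A' \<subseteq> circles D S'" and ind: "i \<in> indices D"
      by (auto simp: states_def)
    have "i \<in> positives D"
      using i(1) ind positives_negatives(1) by blast
    from merge_labelled_crossing[OF ind i(1) l[OF this] sq A'[unfolded i(2)]]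
    show ?thesis
      using True i(2) by (simp add: s lee_d_labelled)
  next
    case False
    then show ?thesis
      by (cases "(S', A') \<in> states D") (auto simp: s lee_d_labelled, simp add: lee_d_def)
  qed
qed

text \<open>Their canonical labels are opposite and nonzero.\<close>

lemma first_neq_second:
  assumes "i \<in> indices D"
  shows "first i \<noteq> second i"
  using canonical_label_crossing[OF assms] canonical_label_square[of "first i"] by auto

text \<open>A preimage lives where \<open>e\<close> is 0-smoothed and the merged circle carries the
  common sign. Splitting at \<open>e\<close> gives back the labelling; all other outgoing edges add
  positive crossings and vanish.\<close>

lemma labelled_boundary:
  assumes sq: "\<And>C. l C * l C = 1"
    and l: "\<And>i. i \<in> positives D \<Longrightarrow> l (second i) = - l (first i)"
    and e: "e \<in> negatives D" "l (second e) = l (first e)"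
  shows "\<exists>b\<in>chains D (- 1). lee_d D b = labelled D (negatives D) l"
proof
  let ?N = "negatives D" and ?p = "first e" and ?q = "second e"
  let ?T = "?N - {e}" and ?r = "?p \<union> ?q"
  let ?l = "l(?r := l ?p)" and ?k = "card {j \<in> ?N. j < e}"
  \<comment> \<open>The power of \<open>-1\<close> cancels the sign of the cube edge that adds
    \<open>e\<close>.\<close>
  let ?b = "\<lambda>s. (-1) ^ ?k * labelled D ?T ?l s"
  have ind: "e \<in> indices D"
    using e(1) negatives_subset by blast
  note neq = first_neq_second[OF ind]
  note pq = first_second_in_circles[OF ind, of ?N]
  note r = merged_notin_circles[OF ind neq]
  have flip: "flip ?N e = ?T"
    using e(1) by (simp add: flip_def)
  note circ = circles_flip[OF ind neq, unfolded flip]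
  have N: "insert e ?T = ?N"
    using e(1) by blast
  have sq': "?l C * ?l C = 1" for C
    using sq by simp
  \<comment> \<open>Seen from the arcs, the merge changes no sign, so the signs at positive
    crossings remain opposite.\<close>
  have l': "?l (circle D ?T x) = l (seifert x)" if x: "x \<in> arcs D" for x
  proof -
    have "seifert x \<noteq> ?r"
      using r x by (auto simp: circles_eq_image)
    then show ?thesis
      using circle_flip[OF ind neq x] e(2) by (auto simp: flip)
  qed
  have pos: "?l (second_circle D ?T i) = - ?l (first_circle D ?T i)" if i: "i \<in> positives D" for i
  proof -
    have "i \<in> indices D"
      using i by (simp add: positives_def)
    then show ?thesis
      using l'[OF slot_arcs(1)] l'[OF slot_arcs(3)] l[OF i]
      unfolding first_circle_def second_circle_def by metis
  qed
  have "card ?T = card ?N - 1" "card ?N > 0"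
    using e(1) finite_negatives by (auto simp: card_gt_0_iff)
  then show "?b \<in> chains D (- 1)"
    using negatives_subset by (intro chains_scale labelled_chains) auto
  show "lee_d D ?b = labelled D ?N l"
    unfolding lee_d_scale
  proof (rule ext)
    fix s :: state
    obtain S' A' where s: "s = (S', A')"
      by (cases s)
    show "(-1) ^ ?k * lee_d D (labelled D ?T ?l) s = labelled D ?N l s"
    proof (cases "s \<in> states D")
      case False
      then have "labelled D ?N l s = 0"
        using negatives_subset by (auto simp: s states_def labelled_def)
      moreover have "lee_d D (labelled D ?T ?l) s = 0"
        using False by (simp add: s lee_d_def)
      ultimately show ?thesis
        by simp
    next
      case True
      then have st: "(S', A') \<in> states D" and A': "A' \<subseteq> circles D S'"
        by (auto simp: s states_def)
      consider "S' = ?N" | i where "i \<notin> ?N" "S' = insert i ?T" | "S' \<noteq> ?N" "\<nexists>i. i \<notin> ?T \<and> S' = insert i ?T"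
        using N by blast
      then show ?thesis
      proof cases
        case 1
        have the: "(THE i. i \<notin> ?T \<and> S' = insert i ?T) = e"
          using 1 N by (intro the_equality) auto
        have ex: "\<exists>i. i \<notin> ?T \<and> S' = insert i ?T"
          using 1 N by auto
        have "lee_d D (labelled D ?T ?l) s = (-1) ^ ?k * labelled D ?N l (?N, A')"
          unfolding s lee_d_labelled[OF st] the
          using ex split_labelled[OF pq neq r circ e(2) sq, of A'] A' 1 by simp
        then show ?thesis
          by (simp add: s 1 flip: power_mult_distrib mult.assoc)
      next
        case (2 i)
        have i: "i \<in> indices D" "i \<notin> ?T"
          using st 2 by (auto simp: states_def)
        have "i \<in> positives D"
          using 2(1) i(1) positives_negatives(1) by blast
        note merge_labelled_crossing[where l = ?l, OF i pos[OF this] sq' A'[unfolded 2(2)], folded 2(2)]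
        then have "lee_d D (labelled D ?T ?l) s = 0"
          unfolding s lee_d_labelled[OF st] by (simp only: mult_zero_right if_cancel)
        moreover have "S' \<noteq> ?N"
          using 2 by blast
        ultimately show ?thesis
          by (simp add: s labelled_def)
      next
        case 3
        then have "lee_d D (labelled D ?T ?l) s = 0"
          unfolding s lee_d_labelled[OF st] by (simp only: if_False)
        then show ?thesis
          using 3(1) by (simp add: s labelled_def)
      qed
    qed
  qed
qed

text \<open>At the oriented resolution the number of 1-smoothings is the number of negative
  crossings, so the degree shift is the writhe.\<close>

lemma qdeg_negatives:
  assumes A: "A \<subseteq> oriented_resolution D"
  shows "qdeg D (negatives D, A) = int (card (oriented_resolution D - A)) - int (card A) + writhe D"
    and "card (oriented_resolution D) = card (oriented_resolution D - A) + card A"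
proof -
  show "qdeg D (negatives D, A) = int (card (oriented_resolution D - A)) - int (card A) + writhe D"
    by (simp add: qdeg_def writhe_def flip: oriented_resolution_def)
  show "card (oriented_resolution D) = card (oriented_resolution D - A) + card A"
    using A finite_oriented_resolution card_mono[OF finite_oriented_resolution A]
    by (simp add: card_Diff_subset finite_subset)
qed

lemma comps_nonempty:
  assumes "Q \<in> comps D W"
  shows "\<exists>x\<in>arcs D. seifert x \<in> Q"
proof -
  obtain C where C: "C \<in> oriented_resolution D" "Q = cls (oriented_resolution D) (edge_rel D W) C"
    using assms unfolding comps_def classes_eq_image by blast
  then have "C \<in> Q"
    by (simp add: cls_self)
  then show ?thesis
    using C(1) unfolding oriented_resolution_eq by blast
qed

text \<open>The strand passes between the two Seifert circles at every crossing, so the Seifert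
  graph is connected. A union of components of \<open>T^+\<close> respected by all negative edges
  too would contain every circle, including those of \<open>P\<close>.\<close>

lemma separating_negative_crossing:
  assumes F: "F \<subseteq> comps D (positives D)" "F \<noteq> {}" and P: "P \<in> comps D (positives D)" "P \<notin> F"
  shows "\<exists>e\<in>negatives D. (first e \<in> \<Union>F) \<noteq> (second e \<in> \<Union>F)"
proof (rule ccontr)
  assume "\<not> ?thesis"
  then have same: "first i \<in> \<Union>F \<longleftrightarrow> second i \<in> \<Union>F" if "i \<in> indices D" for i
    using Union_comps_edge[OF F(1) _ that] that positives_negatives(1) by blast
  have strand: "seifert x \<in> \<Union>F \<longleftrightarrow> seifert y \<in> \<Union>F" if "(x, y) \<in> (strand_rel D)\<^sup>*" for x y
    using that
  proof (induction rule: rtrancl_induct)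
    case (step y z)
    obtain i where i: "i \<in> indices D" "(y, z) \<in> {(u_in (cr i), u_out (cr i)), (o_in (cr i), o_out (cr i))}"
      using step.hyps(2) by (auto simp: strand_rel_def in_set_conv_nth indices_def)
    have "seifert y \<in> \<Union>F \<longleftrightarrow> seifert z \<in> \<Union>F"
      using same[OF i(1)] seifert_slots[OF i(1)] i(2) by auto
    then show ?case
      using step.IH by blast
  qed simp
  obtain Q where "Q \<in> F"
    using F(2) by blast
  then obtain x y where x: "x \<in> arcs D" "seifert x \<in> \<Union>F" and y: "y \<in> arcs D" "seifert y \<in> P"
    using comps_nonempty[of Q] comps_nonempty[OF P(1)] F(1) by blast
  then have "seifert y \<in> \<Union>F"
    using strand[of x y] strands by blast
  then obtain Q' where Q': "Q' \<in> F" "seifert y \<in> Q'"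
    by blast
  then have "P = Q'"
    using comps_eq_cls(2)[OF P(1) y(2)] comps_eq_cls(2)[of Q' "positives D" "seifert y"] F(1) by blast
  then show False
    using P(2) Q'(1) by blast
qed

lemma filtered_cohomology_lower:
  "cohomology_class D 0 (canonical_generator D) \<in>
    filtered_cohomology D (writhe D - int (card (oriented_resolution D)) + 2 * int (card (comps D (positives D))) - 2) 0"
    (is "_ \<in> filtered_cohomology D ?j 0")
proof -
  let ?N = "negatives D" and ?O = "oriented_resolution D"
  have "0 \<in> arcs D"
    by (simp add: arcs_def)
  then obtain P where P: "P \<in> comps D (positives D)"
    unfolding comps_def classes_eq_image oriented_resolution_eq by blast
  \<comment> \<open>Keeping \<open>P\<close> fixed guarantees that every nonempty \<open>F\<close>
    is separated from \<open>P\<close> by a negative crossing, which makes its term a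
    coboundary.\<close>
  define K where "K = comps D (positives D) - {P}"
  have finK: "finite (Pow K)"
    by (simp add: K_def finite_comps)
  define g where "g F = labelled D ?N (flipped F)" for F
  define c where "c s = (\<Sum>F\<in>Pow K. (-1) ^ card F * g F s)" for s
  have pos: "flipped F (second i) = - flipped F (first i)" if "F \<in> Pow K" "i \<in> positives D" for F i
    using that positives_negatives(1) by (intro flipped_crossing[of F "positives D"]) (auto simp: K_def)
  have chain: "g F \<in> chains D 0" for F
    unfolding g_def using negatives_subset by (intro labelled_chains) auto
  have "c \<in> chains D 0"
    \<comment> \<open>The chain \<open>c\<close> is the expanded product of differences; its term
      for \<open>F = {}\<close> is the canonical generator.\<close>
    unfolding c_def[abs_def] by (intro chains_sum finK chain)
  moreover have "lee_d D (g F) = (\<lambda>_. 0)" if "F \<in> Pow K" for F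
    unfolding g_def using flipped_square pos[OF that] by (rule labelled_cocycle)
  then have "lee_d D c = (\<lambda>_. 0)"
    unfolding c_def[abs_def] lee_d_sum[OF finK] by simp
  ultimately have cocycle: "c \<in> cocycles D 0"
    by (simp add: cocycles_def)
  have "\<exists>b\<in>chains D (-1). lee_d D b = g F" if F: "F \<in> Pow K - {{}}" for F
  proof -
    obtain e where e: "e \<in> ?N" "(first e \<in> \<Union>F) \<noteq> (second e \<in> \<Union>F)"
      using separating_negative_crossing[of F P] F P by (auto simp: K_def)
    then have "flipped F (second e) = flipped F (first e)"
      using canonical_label_crossing[of e] negatives_subset by (auto simp: flipped_def)
    then show ?thesis
      unfolding g_def using flipped_square pos F e(1) by (intro labelled_boundary) auto
  qed
  then obtain b where b: "\<And>F. F \<in> Pow K - {{}} \<Longrightarrow> b F \<in> chains D (-1) \<and> lee_d D (b F) = g F"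
    by metis
  define B where "B s = (\<Sum>F\<in>Pow K - {{}}. (-1) ^ card F * b F s)" for s
  have B: "B \<in> chains D (0 - 1)"
    unfolding B_def[abs_def] using b finK by (intro chains_sum) auto
  have "lee_d D B = (\<lambda>s. \<Sum>F\<in>Pow K - {{}}. (-1) ^ card F * g F s)"
    unfolding B_def[abs_def] using b finK by (subst lee_d_sum) auto
  moreover have "flipped {} = canonical_label"
    by (simp add: flipped_def fun_eq_iff)
  then have "c s = canonical_generator D s + (\<Sum>F\<in>Pow K - {{}}. (-1) ^ card F * g F s)" for s
    unfolding c_def using sum.remove[OF finK, of "{}" "\<lambda>F. (-1) ^ card F * g F s"] by (simp add: g_def canonical_generator_eq)
  ultimately have "c = (\<lambda>s. canonical_generator D s + lee_d D B s)"
    by (simp add: fun_eq_iff)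
  then have "cohomology_class D 0 c = cohomology_class D 0 (canonical_generator D)"
    by (rule cohomology_class_eqI[OF B])
  moreover have "?j \<le> qdeg D s" if nz: "c s \<noteq> 0" for s
  proof -
    obtain S A where s: "s = (S, A)"
      by (cases s)
    have "\<exists>F\<in>Pow K. g F s \<noteq> 0"
      using nz unfolding c_def by (metis (mono_tags, lifting) mult_zero_right sum.neutral)
    then have S: "S = ?N" and A: "A \<subseteq> ?O"
      unfolding g_def labelled_def s by (auto simp: oriented_resolution_def split: if_splits)
    have "g F s = (\<Prod>C\<in>?O - A. flipped F C)" for F
      using A by (simp add: g_def s S labelled_def oriented_resolution_def)
    then have "(\<Sum>F\<in>Pow K. (-1) ^ card F * (\<Prod>C\<in>?O - A. flipped F C)) \<noteq> 0"
      using nz by (simp add: c_def)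
    \<comment> \<open>Since \<open>P\<close> is left out, at least \<open>#T^+ - 1\<close> circles
      are labelled 1. The degree is \<open>w - V\<close> plus twice their number, whence the final
      \<open>- 2\<close>.\<close>
    then have "card K \<le> card (?O - A)"
      using finite_oriented_resolution by (intro flipped_sum_support[of K "positives D"]) (auto simp: K_def)
    moreover have "card (comps D (positives D)) = card K + 1"
      using card.remove[OF finite_comps P] by (simp add: K_def)
    ultimately show ?thesis
      using qdeg_negatives[OF A] by (simp add: s S)
  qed
  then have "c \<in> filtered_chains D ?j 0"
    using \<open>c \<in> chains D 0\<close> by (simp add: filtered_chains_def)
  ultimately show ?thesis
    unfolding filtered_cohomology_def using cocycle by (metis IntI imageI)
qed

lemma filtered_cohomology_upper:
  assumes "cohomology_class D 0 (canonical_generator D) \<in> filtered_cohomology D j 0"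
  shows "j \<le> writhe D + int (card (oriented_resolution D)) - 2 * int (card (comps D (negatives D)))"
proof -
  let ?N = "negatives D" and ?O = "oriented_resolution D"
  define K where "K = comps D ?N"
  have finK: "finite (Pow K)"
    by (simp add: K_def finite_comps)
  obtain c where c: "c \<in> filtered_chains D j 0"
    and eq: "cohomology_class D 0 (canonical_generator D) = cohomology_class D 0 c"
    using assms by (auto simp: filtered_cohomology_def)
  have "canonical_generator D \<in> cohomology_class D 0 (canonical_generator D)"
    unfolding cohomology_class_def
    by (auto simp: lee_d_zero chains_def intro!: bexI[of _ "\<lambda>_. 0"])
  then obtain b where b: "canonical_generator D = (\<lambda>s. c s + lee_d D b s)"
    unfolding eq unfolding cohomology_class_def by blast
  \<comment> \<open>The inner product pairs the state \<open>A\<close> with the tensor of the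
    \<open>x + \<lambda>\<close>, as \<open>\<epsilon>(x (x + \<lambda>)) = \<lambda>\<close> and
    \<open>\<epsilon>(x + \<lambda>) = 1\<close>. The signed sum takes the differences over all
    components of \<open>T^-\<close>.\<close>
  define phi where "phi A = (\<Sum>F\<in>Pow K. (-1) ^ card F * (\<Prod>C\<in>A. flipped F C))" for A
  define pairing where "pairing f = (\<Sum>A\<in>Pow ?O. phi A * f (?N, A))" for f :: chain
  \<comment> \<open>A cube edge into the oriented resolution adds a negative crossing and splits a
    circle there. The signs at this edge of \<open>T^-\<close> are opposite for every
    \<open>F\<close>, so each pairing vanishes.\<close>
  have edge: "(\<Sum>A\<in>Pow ?O. phi A * edge_coeff D (?N - {i}, A') (?N, A)) = 0"
    if i: "i \<in> ?N" and A': "A' \<subseteq> circles D (?N - {i})" for i A'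
  proof -
    have ind: "i \<in> indices D"
      using i negatives_subset by blast
    note neq = first_neq_second[OF ind]
    have "flip ?N i = ?N - {i}"
      using i by (simp add: flip_def)
    note circ = circles_flip[OF ind neq, unfolded this]
    have "(\<Sum>A\<in>Pow ?O. edge_coeff D (?N - {i}, A') (?N, A) * (\<Prod>C\<in>A. flipped F C)) = 0"
      if F: "F \<in> Pow K" for F
      unfolding oriented_resolution_def
      using first_second_in_circles[OF ind] neq merged_notin_circles[OF ind neq] circ _ flipped_square A'
      by (rule split_pairing) (use F flipped_crossing[OF _ i ind] in \<open>auto simp: K_def\<close>)
    then have "(\<Sum>F\<in>Pow K. (-1) ^ card F *
        (\<Sum>A\<in>Pow ?O. edge_coeff D (?N - {i}, A') (?N, A) * (\<Prod>C\<in>A. flipped F C))) = 0"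
      by simp
    then show ?thesis
      unfolding phi_def sum_distrib_left sum_distrib_right
      by (subst sum.swap) (simp add: mult_ac)
  qed
  have "pairing (lee_d D b) = 0"
  proof -
    let ?C = "\<lambda>i. circles D (?N - {i})" and ?sg = "\<lambda>i. (-1) ^ card {k \<in> ?N. k < i} :: complex"
    have "lee_d D b (?N, A) = (\<Sum>i\<in>?N. \<Sum>A'\<in>Pow (?C i).
        ?sg i * edge_coeff D (?N - {i}, A') (?N, A) * b (?N - {i}, A'))" if "A \<in> Pow ?O" for A
      using that negatives_subset by (simp add: lee_d_def states_def oriented_resolution_def)
    then have "pairing (lee_d D b) = (\<Sum>A\<in>Pow ?O. \<Sum>i\<in>?N. \<Sum>A'\<in>Pow (?C i).
        phi A * (?sg i * edge_coeff D (?N - {i}, A') (?N, A) * b (?N - {i}, A')))"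
      unfolding pairing_def by (intro sum.cong refl) (simp add: sum_distrib_left)
    also have "\<dots> = (\<Sum>i\<in>?N. \<Sum>A'\<in>Pow (?C i). \<Sum>A\<in>Pow ?O.
        phi A * (?sg i * edge_coeff D (?N - {i}, A') (?N, A) * b (?N - {i}, A')))"
      by (subst sum.swap) (intro sum.cong refl sum.swap)
    also have "\<dots> = (\<Sum>i\<in>?N. \<Sum>A'\<in>Pow (?C i). ?sg i * b (?N - {i}, A') *
        (\<Sum>A\<in>Pow ?O. phi A * edge_coeff D (?N - {i}, A') (?N, A)))"
      unfolding sum_distrib_left by (intro sum.cong refl) (simp add: mult_ac)
    also have "\<dots> = 0"
      using edge by (intro sum.neutral ballI) auto
    finally show ?thesis .
  qed
  then have "pairing c = pairing (canonical_generator D)"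
    unfolding b pairing_def by (simp add: distrib_left sum.distrib)
  also have "\<dots> = (\<Sum>A\<in>Pow ?O. \<Sum>F\<in>Pow K. (-1) ^ card F *
      ((\<Prod>C\<in>A. flipped F C) * (\<Prod>C\<in>?O - A. canonical_label C)))"
    unfolding pairing_def phi_def canonical_generator_eq labelled_def
    by (intro sum.cong refl) (simp add: sum_distrib_right mult.assoc oriented_resolution_def)
  \<comment> \<open>Summation over \<open>A\<close> expands a product over the circles. A reversed
    circle gives the factor 0, so only \<open>F = {}\<close> survives, with factors
    \<open>2 \<lambda>\<close>.\<close>
  also have "\<dots> = (\<Sum>F\<in>Pow K. (-1) ^ card F * (\<Prod>C\<in>?O. flipped F C + canonical_label C))"
    unfolding prod_add[OF finite_oriented_resolution] sum_distrib_left by (rule sum.swap)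
  also have "\<dots> = (\<Sum>F\<in>{{}}. (-1) ^ card F * (\<Prod>C\<in>?O. flipped F C + canonical_label C))"
  proof (rule sum.mono_neutral_right[OF finK])
    show "\<forall>F\<in>Pow K - {{}}. (-1) ^ card F * (\<Prod>C\<in>?O. flipped F C + canonical_label C) = 0"
    proof
      fix F
      assume F: "F \<in> Pow K - {{}}"
      then obtain Q where Q: "Q \<in> F" "Q \<in> comps D ?N"
        by (auto simp: K_def)
      then obtain C where C: "C \<in> ?O" "C \<in> Q"
        using comps_nonempty oriented_resolution_eq by blast
      then have "flipped F C + canonical_label C = 0"
        using Q(1) by (auto simp: flipped_def)
      then have "(\<Prod>C\<in>?O. flipped F C + canonical_label C) = 0"
        using C(1) finite_oriented_resolution by (intro prod_zero) auto
      then show "(-1) ^ card F * (\<Prod>C\<in>?O. flipped F C + canonical_label C) = 0"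
        by simp
    qed
  qed auto
  also have "\<dots> \<noteq> 0"
    using finite_oriented_resolution by (auto simp: flipped_def canonical_label_def)
  finally obtain A where A: "A \<subseteq> ?O" "phi A \<noteq> 0" "c (?N, A) \<noteq> 0"
    unfolding pairing_def by (metis (no_types, lifting) PowD mult_eq_0_iff sum.neutral)
  \<comment> \<open>Here the support bound concerns the circles labelled x; the degree is
    \<open>w + V - 2 |A|\<close>.\<close>
  have "card K \<le> card A"
    using A(2) finite_subset[OF A(1) finite_oriented_resolution] unfolding phi_def
    by (intro flipped_sum_support[of K ?N]) (auto simp: K_def)
  moreover have "j \<le> qdeg D (?N, A)"
    using c A(3) by (auto simp: filtered_chains_def)
  ultimately show ?thesis
    using qdeg_negatives[OF A(1)] by (simp add: K_def)
qed

end

theorem proposition1p5: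
  fixes D :: diagram
  assumes "knot_diagram D" and "alternating D"
  shows "rasmussen_s D = U D"
proof -
  interpret alternating_knot D
    using assms by unfold_locales
  let ?m = "writhe D + int (card (oriented_resolution D)) - 2 * int (card (comps D (negatives D)))"
  let ?l = "writhe D - int (card (oriented_resolution D)) + 2 * int (card (comps D (positives D))) - 2"
  \<comment> \<open>Membership in degree \<open>?l\<close> gives \<open>?l \<le> ?m\<close> by the
    upper bound; the component count gives the converse.\<close>
  have "?l = ?m"
    using card_comps_ge filtered_cohomology_upper[OF filtered_cohomology_lower] by linarith
  then have "cohomology_class D 0 (canonical_generator D) \<in> filtered_cohomology D ?m 0"
    using filtered_cohomology_lower by (simp only:)
  then have "s_min D = ?m"
    unfolding s_min_def using filtered_cohomology_upper by (intro Greatest_equality) auto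
  then show ?thesis
    by (simp add: rasmussen_s_def U_def components_negative_subgraph nodes_seifert_graph)
qed

end
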